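(* Let $(G_j)_{j\in J}$ be a family of Lie groups $G_j$ modelled on locally convex spaces. If each $G_j$ is complete (resp., sequentially complete), then also the weak direct product $\bigoplus_{j\in J}G_j$ is complete (resp., sequentially complete).
   Context: A net $(x_\alpha)_{\alpha\in A}$ in a topological group $G$ is a left Cauchy net if for each identity neighbourhood $U$ there is $\gamma\in A$ with $x_\beta^{-1}x_\alpha\in U$ for all $\alpha,\beta\ge\gamma$. $G$ is complete (resp., sequentially complete) if every left Cauchy net (resp., left Cauchy sequence) converges. Smoothness is understood in the Bastiani (Keller $C^k_c$) sense: for Hausdorff locally convex real topological vector spaces $E,F$ and open $U\subseteq E$, a map $f\colon U\to F$ is $C^k$ if it is continuous and all iterated directional derivatives $d^{(i)}f(x,y_1,\ldots,y_i)$ with $i\le k$ exist and are continuous in $(x,y_1,\ldots,y_i)\in U\times E^i$; $C^\infty$ means $C^k$ for all $k$. A Lie group modelled on a (Hausdorff) locally convex space $E$ is a group with a Hausdorff smooth manifold structure modelled on $E$ making the group operations smooth; it is a Hausdorff topological group. For a family of Lie groups $G_j$ modelled on locally convex spaces $E_j$, the weak direct product is the group $$\bigoplus_{j\in J}G_j:=\Big\{(x_j)_{j\in J}\in\prod_{j\in J}G_j:\ x_j=e\text{ for all but finitely many } j\Big\},$$ endowed with the Lie group structure modelled on the locally convex direct sum $\bigoplus_{j\in J}E_j$ such that, for some $C^\infty$-diffeomorphisms $\phi_j\colon U_j\to V_j$ from open identity neighbourhoods $U_j\subseteq G_j$ onto open $0$-neighbourhoods $V_j\subseteq E_j$ with $\phi_j(e)=0$,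 the set $\bigoplus_{j}U_j:=\bigoplus_jG_j\cap\prod_jU_j$ is an open identity neighbourhood and the map $\bigoplus_jU_j\to\bigoplus_jV_j:=\bigoplus_jE_j\cap\prod_jV_j$, $(x_j)_j\mapsto(\phi_j(x_j))_j$, is a $C^\infty$-diffeomorphism. (The locally convex direct sum topology on $\bigoplus_jE_j$ is defined by the seminorms $x\mapsto\sum_jq_j(x_j)$, with $q_j$ ranging over continuous seminorms on $E_j$.) *)

theory Defs
  imports "HOL-Analysis.Analysis" "HOL-Analysis.Finite_Function_Topology" "HOL-Algebra.Product_Groups"
begin

section \<open>Completeness in the left uniformity\<close>

definition directed_set :: "'i set \<Rightarrow> ('i \<Rightarrow> 'i \<Rightarrow> bool) \<Rightarrow> bool" where
  "directed_set A leq \<longleftrightarrow> A \<noteq> {} \<and> (\<forall>a\<in>A. leq a a) \<and>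
     (\<forall>a\<in>A. \<forall>b\<in>A. \<forall>c\<in>A. leq a b \<longrightarrow> leq b c \<longrightarrow> leq a c) \<and>
     (\<forall>a\<in>A. \<forall>b\<in>A. \<exists>c\<in>A. leq a c \<and> leq b c)"

definition net_converges ::
  "'a topology \<Rightarrow> 'i set \<Rightarrow> ('i \<Rightarrow> 'i \<Rightarrow> bool) \<Rightarrow> ('i \<Rightarrow> 'a) \<Rightarrow> 'a \<Rightarrow> bool" where
  "net_converges X A leq x l \<longleftrightarrow> l \<in> topspace X \<and>
     (\<forall>U. openin X U \<and> l \<in> U \<longrightarrow> (\<exists>c\<in>A. \<forall>a\<in>A. leq c a \<longrightarrow> x a \<in> U))"

definition left_Cauchy_net ::
  "('g, 'm) monoid_scheme \<Rightarrow> 'g topology \<Rightarrow> 'i set \<Rightarrow> ('i \<Rightarrow> 'i \<Rightarrow> bool) \<Rightarrow> ('i \<Rightarrow> 'g) \<Rightarrow> bool" where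
  "left_Cauchy_net G X A leq x \<longleftrightarrow> directed_set A leq \<and> x \<in> A \<rightarrow> carrier G \<and>
     (\<forall>U. openin X U \<and> \<one>\<^bsub>G\<^esub> \<in> U \<longrightarrow>
        (\<exists>c\<in>A. \<forall>a\<in>A. \<forall>b\<in>A. leq c a \<and> leq c b \<longrightarrow> inv\<^bsub>G\<^esub> (x b) \<otimes>\<^bsub>G\<^esub> x a \<in> U))"

text \<open>
  A definition cannot quantify over all index types. Index sets \<open>A :: 'g set set\<close> with an arbitrary
  directed preorder suffice: lemma \<open>complete_groupD\<close> below shows that in a topological group
  they already force convergence of left Cauchy nets over directed sets of every type.
\<close>

definition complete_group :: "('g, 'm) monoid_scheme \<Rightarrow> 'g topology \<Rightarrow> bool" where
  "complete_group G X \<longleftrightarrow>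
     (\<forall>(A :: 'g set set) leq x. left_Cauchy_net G X A leq x \<longrightarrow> (\<exists>l. net_converges X A leq x l))"

definition sequentially_complete_group :: "('g, 'm) monoid_scheme \<Rightarrow> 'g topology \<Rightarrow> bool" where
  "sequentially_complete_group G X \<longleftrightarrow>
     (\<forall>x. left_Cauchy_net G X (UNIV :: nat set) (\<le>) x \<longrightarrow> (\<exists>l. net_converges X UNIV (\<le>) x l))"

definition topological_group :: "('g, 'm) monoid_scheme \<Rightarrow> 'g topology \<Rightarrow> bool" where
  "topological_group G X \<longleftrightarrow> group G \<and> topspace X = carrier G \<and>
     continuous_map (prod_topology X X) X (\<lambda>(x, y). x \<otimes>\<^bsub>G\<^esub> y) \<and>
     continuous_map X X (m_inv G)"

section \<open>Locally convex spaces and Bastiani calculus\<close>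

text \<open>
  A locally convex space is given by a topology on a linear subspace (its \<^const>\<open>topspace\<close>) of an
  ambient real vector space, which carries the linear structure only. As every family of vector
  spaces embeds into a common vector space, families may be modelled over one ambient type.
\<close>

definition locally_convex_tvs :: "'e::real_vector topology \<Rightarrow> bool" where
  "locally_convex_tvs E \<longleftrightarrow> subspace (topspace E) \<and> Hausdorff_space E \<and>
     continuous_map (prod_topology E E) E (\<lambda>(x, y). x + y) \<and>
     continuous_map (prod_topology euclideanreal E) E (\<lambda>(c, x). c *\<^sub>R x) \<and>
     (\<forall>U. openin E U \<and> 0 \<in> U \<longrightarrow> (\<exists>C. openin E C \<and> 0 \<in> C \<and> convex C \<and> C \<subseteq> U))"

definition continuous_seminorm :: "'e::real_vector topology \<Rightarrow> ('e \<Rightarrow> real) \<Rightarrow> bool" where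
  "continuous_seminorm E q \<longleftrightarrow> continuous_map E euclideanreal q \<and>
     (\<forall>x\<in>topspace E. \<forall>y\<in>topspace E. q (x + y) \<le> q x + q y) \<and>
     (\<forall>c. \<forall>x\<in>topspace E. q (c *\<^sub>R x) = \<bar>c\<bar> * q x)"

definition direct_sum_carrier ::
  "'j set \<Rightarrow> ('j \<Rightarrow> 'e::real_vector set) \<Rightarrow> ('j \<Rightarrow>\<^sub>0 'e) set" where
  "direct_sum_carrier J S =
     {x. Poly_Mapping.keys x \<subseteq> J \<and> (\<forall>j\<in>J. Poly_Mapping.lookup x j \<in> S j)}"

definition direct_sum_topology ::
  "'j set \<Rightarrow> ('j \<Rightarrow> 'e::real_vector topology) \<Rightarrow> ('j \<Rightarrow>\<^sub>0 'e) topology" where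
  "direct_sum_topology J E =
     (let S = direct_sum_carrier J (\<lambda>j. topspace (E j));
          p = (\<lambda>q x. \<Sum>j\<in>Poly_Mapping.keys x. q j (Poly_Mapping.lookup x j))
      in topology_generated_by
           {{y \<in> S. p q (y - x) < r} | q x r.
              (\<forall>j\<in>J. continuous_seminorm (E j) (q j)) \<and> x \<in> S \<and> r > 0})"

definition has_dir_deriv ::
  "'f::real_vector topology \<Rightarrow> ('e::real_vector \<Rightarrow> 'f) \<Rightarrow> 'e \<Rightarrow> 'e \<Rightarrow> 'f \<Rightarrow> bool" where
  "has_dir_deriv F f x y l \<longleftrightarrow> limitin F (\<lambda>t::real. (f (x + t *\<^sub>R y) - f x) /\<^sub>R t) l (at 0)"

definition dir_deriv ::
  "'f::real_vector topology \<Rightarrow> ('e::real_vector \<Rightarrow> 'f) \<Rightarrow> 'e \<Rightarrow> 'e \<Rightarrow> 'f" where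
  "dir_deriv F f x y = (THE l. has_dir_deriv F f x y l)"

text \<open>
  \<open>iter_dir_deriv F f i x y\<close> is $d^{(i)}f(x, y_0, \ldots, y_{i-1})$; the values \<open>y j\<close> with
  \<open>j \<ge> i\<close> are irrelevant.
\<close>

primrec iter_dir_deriv ::
  "'f::real_vector topology \<Rightarrow> ('e::real_vector \<Rightarrow> 'f) \<Rightarrow> nat \<Rightarrow> 'e \<Rightarrow> (nat \<Rightarrow> 'e) \<Rightarrow> 'f" where
  "iter_dir_deriv F f 0 = (\<lambda>x y. f x)"
| "iter_dir_deriv F f (Suc i) = (\<lambda>x y. dir_deriv F (\<lambda>z. iter_dir_deriv F f i z y) x (y i))"

definition C_k_on ::
  "nat \<Rightarrow> 'e::real_vector topology \<Rightarrow> 'f::real_vector topology \<Rightarrow> 'e set \<Rightarrow> ('e \<Rightarrow> 'f) \<Rightarrow> bool" where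
  "C_k_on k E F U f \<longleftrightarrow> openin E U \<and>
     (\<forall>i<k. \<forall>x\<in>U. \<forall>y \<in> {..<Suc i} \<rightarrow>\<^sub>E topspace E.
        \<exists>l. has_dir_deriv F (\<lambda>z. iter_dir_deriv F f i z y) x (y i) l) \<and>
     (\<forall>i\<le>k. continuous_map
        (prod_topology (subtopology E U) (product_topology (\<lambda>_. E) {..<i})) F
        (\<lambda>(x, y). iter_dir_deriv F f i x y))"

definition C_infinity_on ::
  "'e::real_vector topology \<Rightarrow> 'f::real_vector topology \<Rightarrow> 'e set \<Rightarrow> ('e \<Rightarrow> 'f) \<Rightarrow> bool" where
  "C_infinity_on E F U f \<longleftrightarrow> (\<forall>k. C_k_on k E F U f)"

section \<open>Manifolds and Lie groups modelled on locally convex spaces\<close>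

text \<open>
  The smooth structure is given by an atlas, not necessarily maximal; a chart is a pair of its domain
  and a map. The notions below do not change when the atlas is replaced by an equivalent one.
\<close>

record ('m, 'e) manifold =
  mtop :: "'m topology"
  model :: "'e topology"
  atlas :: "('m set \<times> ('m \<Rightarrow> 'e)) set"

definition smooth_manifold :: "('m, 'e::real_vector) manifold \<Rightarrow> bool" where
  "smooth_manifold M \<longleftrightarrow> locally_convex_tvs (model M) \<and> Hausdorff_space (mtop M) \<and>
     (\<Union>(U, \<phi>)\<in>atlas M. U) = topspace (mtop M) \<and>
     (\<forall>(U, \<phi>)\<in>atlas M. openin (mtop M) U \<and> openin (model M) (\<phi> ` U) \<and>
        homeomorphic_map (subtopology (mtop M) U) (subtopology (model M) (\<phi> ` U)) \<phi>) \<and>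
     (\<forall>(U, \<phi>)\<in>atlas M. \<forall>(V, \<psi>)\<in>atlas M.
        C_infinity_on (model M) (model M) (\<phi> ` (U \<inter> V)) (\<psi> \<circ> inv_into U \<phi>))"

definition smooth_map ::
  "('m, 'e::real_vector) manifold \<Rightarrow> ('n, 'f::real_vector) manifold \<Rightarrow> ('m \<Rightarrow> 'n) \<Rightarrow> bool" where
  "smooth_map M N f \<longleftrightarrow> continuous_map (mtop M) (mtop N) f \<and>
     (\<forall>(U, \<phi>)\<in>atlas M. \<forall>(V, \<psi>)\<in>atlas N.
        C_infinity_on (model M) (model N) (\<phi> ` {x \<in> U. f x \<in> V}) (\<psi> \<circ> f \<circ> inv_into U \<phi>))"

definition diffeomorphism ::
  "('m, 'e::real_vector) manifold \<Rightarrow> ('n, 'f::real_vector) manifold \<Rightarrow> ('m \<Rightarrow> 'n) \<Rightarrow> bool" where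
  "diffeomorphism M N f \<longleftrightarrow> bij_betw f (topspace (mtop M)) (topspace (mtop N)) \<and>
     smooth_map M N f \<and> smooth_map N M (inv_into (topspace (mtop M)) f)"

definition open_submanifold :: "('m, 'e) manifold \<Rightarrow> 'm set \<Rightarrow> ('m, 'e) manifold" where
  "open_submanifold M W =
     \<lparr>mtop = subtopology (mtop M) W, model = model M, atlas = (\<lambda>(U, \<phi>). (U \<inter> W, \<phi>)) ` atlas M\<rparr>"

definition prod_manifold ::
  "('m, 'e) manifold \<Rightarrow> ('n, 'f) manifold \<Rightarrow> ('m \<times> 'n, 'e \<times> 'f) manifold" where
  "prod_manifold M N =
     \<lparr>mtop = prod_topology (mtop M) (mtop N), model = prod_topology (model M) (model N),
      atlas = {(U \<times> V, map_prod \<phi> \<psi>) | U \<phi> V \<psi>. (U, \<phi>) \<in> atlas M \<and> (V, \<psi>) \<in> atlas N}\<rparr>"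

definition space_manifold :: "'e topology \<Rightarrow> ('e, 'e) manifold" where
  "space_manifold E = \<lparr>mtop = E, model = E, atlas = {(topspace E, id)}\<rparr>"

locale lie_group = group G for G :: "('g, 'm) monoid_scheme" (structure) +
  fixes M :: "('g, 'e::real_vector) manifold"
  assumes manifold: "smooth_manifold M"
    and topspace_eq_carrier: "topspace (mtop M) = carrier G"
    and smooth_mult: "smooth_map (prod_manifold M M) M (\<lambda>(x, y). x \<otimes> y)"
    and smooth_inv: "smooth_map M M (m_inv G)"

text \<open>
  The group \<^const>\<open>sum_group\<close> is the weak direct product. \<open>weak_direct_product_lie_group J G M N\<close>
  states that \<open>N\<close> is its Lie group structure for the family of Lie groups \<open>(G j, M j)\<close>. Elements of
  \<^const>\<open>sum_group\<close> are functions extensional on \<open>J\<close>, whereas those of the direct sum of the model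
  spaces vanish off \<open>J\<close>.
\<close>

definition weak_direct_product_lie_group ::
  "'j set \<Rightarrow> ('j \<Rightarrow> ('g, 'm) monoid_scheme) \<Rightarrow> ('j \<Rightarrow> ('g, 'e::real_vector) manifold) \<Rightarrow>
   ('j \<Rightarrow> 'g, 'j \<Rightarrow>\<^sub>0 'e) manifold \<Rightarrow> bool" where
  "weak_direct_product_lie_group J G M N \<longleftrightarrow>
     lie_group (sum_group J G) N \<and>
     model N = direct_sum_topology J (\<lambda>j. model (M j)) \<and>
     (\<exists>U V \<phi>.
        (\<forall>j\<in>J. openin (mtop (M j)) (U j) \<and> \<one>\<^bsub>G j\<^esub> \<in> U j \<and>
           openin (model (M j)) (V j) \<and> 0 \<in> V j \<and> \<phi> j \<one>\<^bsub>G j\<^esub> = 0 \<and>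
           diffeomorphism (open_submanifold (M j) (U j))
             (open_submanifold (space_manifold (model (M j))) (V j)) (\<phi> j)) \<and>
        (let U' = carrier (sum_group J G) \<inter> (\<Pi>\<^sub>E j\<in>J. U j);
             V' = direct_sum_carrier J V
         in openin (mtop N) U' \<and>
            diffeomorphism (open_submanifold N U')
              (open_submanifold (space_manifold (model N)) V')
              (\<lambda>x. Abs_poly_mapping (\<lambda>j. \<phi> j (x j) when j \<in> J))))"

section \<open>Adequacy of the definition of completeness\<close>

lemma (in lie_group) topological_group: "topological_group G (mtop M)"
  using smooth_mult smooth_inv topspace_eq_carrier group_axioms
  by (simp add: topological_group_def smooth_map_def prod_manifold_def)

lemma complete_groupD:
  fixes G :: "('g, 'm) monoid_scheme" and A :: "'i set"
  assumes tg: "topological_group G X" and compl: "complete_group G X"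
    and Cauchy: "left_Cauchy_net G X A leq x"
  shows "\<exists>l. net_converges X A leq x l"
proof -
  interpret group G using tg by (simp add: topological_group_def)
  have top: "topspace X = carrier G" 
    and cmult: "continuous_map (prod_topology X X) X (\<lambda>(x, y). x \<otimes>\<^bsub>G\<^esub> y)"
    and cinv: "continuous_map X X (m_inv G)"
    using tg by (auto simp: topological_group_def)
  have cancel: "a \<otimes>\<^bsub>G\<^esub> (inv\<^bsub>G\<^esub> a \<otimes>\<^bsub>G\<^esub> b) = b" if "a \<in> carrier G" "b \<in> carrier G" for a b
    using that by (simp add: m_assoc[symmetric])
  have dir: "directed_set A leq" and xA: "\<And>a. a \<in> A \<Longrightarrow> x a \<in> carrier G"
    using Cauchy by (auto simp: left_Cauchy_net_def)
  define \<U> where "\<U> = {U. openin X U \<and> \<one>\<^bsub>G\<^esub> \<in> U}"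
  have UNIV_U: "carrier G \<in> \<U>"
    using top by (auto simp: \<U>_def) (metis openin_topspace)
  have "\<forall>U\<in>\<U>. \<exists>c\<in>A. \<forall>a\<in>A. \<forall>b\<in>A. leq c a \<and> leq c b \<longrightarrow> inv\<^bsub>G\<^esub> (x b) \<otimes>\<^bsub>G\<^esub> x a \<in> U"
    using Cauchy by (auto simp: left_Cauchy_net_def \<U>_def)
  then obtain g where "\<forall>U\<in>\<U>. g U \<in> A \<and> (\<forall>a\<in>A. \<forall>b\<in>A. leq (g U) a \<and> leq (g U) b \<longrightarrow>
      inv\<^bsub>G\<^esub> (x b) \<otimes>\<^bsub>G\<^esub> x a \<in> U)"
    unfolding Bex_def by (auto dest!: bchoice)
  then have g: "\<And>U. U \<in> \<U> \<Longrightarrow> g U \<in> A"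
    and gU: "\<And>U a b. \<lbrakk>U \<in> \<U>; a \<in> A; b \<in> A; leq (g U) a; leq (g U) b\<rbrakk> \<Longrightarrow> inv\<^bsub>G\<^esub> (x b) \<otimes>\<^bsub>G\<^esub> x a \<in> U"
    by blast+
  have refl: "leq a a" if "a \<in> A" for a using dir that unfolding directed_set_def by blast
  have ub: "\<exists>c\<in>A. leq a c \<and> leq b c" if "a \<in> A" "b \<in> A" for a b
    using dir that unfolding directed_set_def by blast
  have dirU: "directed_set \<U> (\<lambda>U V. V \<subseteq> U)"
    unfolding directed_set_def
  proof (intro conjI ballI impI)
    fix U V assume "U \<in> \<U>" "V \<in> \<U>"
    then have "U \<inter> V \<in> \<U>" by (auto simp: \<U>_def)
    then show "\<exists>W\<in>\<U>. W \<subseteq> U \<and> W \<subseteq> V" by blast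
  qed (use UNIV_U in auto)
  have factor: "\<exists>W\<in>\<U>. \<forall>a\<in>W. \<forall>b\<in>W. h a b \<in> Q"
    if h: "continuous_map (prod_topology X X) X (\<lambda>(a, b). h a b)"
      and Q: "openin X Q" "h \<one>\<^bsub>G\<^esub> \<one>\<^bsub>G\<^esub> \<in> Q" for h :: "'g \<Rightarrow> 'g \<Rightarrow> 'g" and Q
  proof -
    define P where "P = {p \<in> topspace (prod_topology X X). (\<lambda>(a, b). h a b) p \<in> Q}"
    have "openin (prod_topology X X) P"
      unfolding P_def by (rule openin_continuous_map_preimage[OF h Q(1)])
    moreover have "(\<one>\<^bsub>G\<^esub>, \<one>\<^bsub>G\<^esub>) \<in> P" using Q top by (simp add: P_def)
    ultimately obtain W1 W2 where W: "openin X W1" "openin X W2" "\<one>\<^bsub>G\<^esub> \<in> W1" "\<one>\<^bsub>G\<^esub> \<in> W2" "W1 \<times> W2 \<subseteq> P"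
      unfolding openin_prod_topology_alt by metis
    then have "W1 \<inter> W2 \<in> \<U>" by (auto simp: \<U>_def)
    moreover have "\<forall>a\<in>W1 \<inter> W2. \<forall>b\<in>W1 \<inter> W2. h a b \<in> Q" using W(5) unfolding P_def by auto
    ultimately show ?thesis by blast
  qed
  have cont_fst: "continuous_map (prod_topology X X) X fst"
    and cont_snd: "continuous_map (prod_topology X X) X snd"
    by (auto intro: continuous_map_fst continuous_map_snd)
  have mult_comp: "continuous_map T X (\<lambda>p. f p \<otimes>\<^bsub>G\<^esub> k p)"
    if "continuous_map T X f" "continuous_map T X k" for T :: "('g \<times> 'g) topology" and f k
  proof -
    have "continuous_map T (prod_topology X X) (\<lambda>p. (f p, k p))"
      using that by (simp add: continuous_map_pairedI)
    from continuous_map_compose[OF this cmult] show ?thesis by (simp add: o_def)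
  qed
  have carU: "U \<subseteq> carrier G" if "U \<in> \<U>" for U
    using that top openin_subset by (auto simp: \<U>_def)
  have "left_Cauchy_net G X \<U> (\<lambda>U V. V \<subseteq> U) (\<lambda>U. x (g U))"
    unfolding left_Cauchy_net_def
  proof (intro conjI allI impI)
    show "(\<lambda>U. x (g U)) \<in> \<U> \<rightarrow> carrier G" using g xA by blast
  next
    fix Q assume "openin X Q \<and> \<one>\<^bsub>G\<^esub> \<in> Q"
    moreover have "continuous_map (prod_topology X X) X (\<lambda>p. fst p \<otimes>\<^bsub>G\<^esub> inv\<^bsub>G\<^esub> (snd p))"
      by (intro mult_comp cont_fst) (use continuous_map_compose[OF cont_snd cinv] in \<open>simp add: o_def\<close>)
    then have "continuous_map (prod_topology X X) X (\<lambda>(a, b). a \<otimes>\<^bsub>G\<^esub> inv\<^bsub>G\<^esub> b)"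
      by (simp add: case_prod_unfold)
    ultimately obtain W where W: "W \<in> \<U>" "\<And>a b. a \<in> W \<Longrightarrow> b \<in> W \<Longrightarrow> a \<otimes>\<^bsub>G\<^esub> inv\<^bsub>G\<^esub> b \<in> Q"
      using factor[of "\<lambda>a b. a \<otimes>\<^bsub>G\<^esub> inv\<^bsub>G\<^esub> b" Q] by auto
    show "\<exists>W\<in>\<U>. \<forall>U\<in>\<U>. \<forall>V\<in>\<U>. U \<subseteq> W \<and> V \<subseteq> W \<longrightarrow> inv\<^bsub>G\<^esub> x (g V) \<otimes>\<^bsub>G\<^esub> x (g U) \<in> Q"
    proof (intro bexI[OF _ W(1)] ballI impI)
      fix U V assume UV: "U \<in> \<U>" "V \<in> \<U>" "U \<subseteq> W \<and> V \<subseteq> W"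
      obtain c where c: "c \<in> A" "leq (g U) c" "leq (g V) c" using ub g UV by metis
      have c1: "inv\<^bsub>G\<^esub> x (g V) \<otimes>\<^bsub>G\<^esub> x c \<in> W"
        using gU[OF UV(2) c(1) g[OF UV(2)]] c refl g UV by blast
      have c2: "inv\<^bsub>G\<^esub> x (g U) \<otimes>\<^bsub>G\<^esub> x c \<in> W"
        using gU[OF UV(1) c(1) g[OF UV(1)]] c refl g UV by blast
      have car: "x (g U) \<in> carrier G" "x (g V) \<in> carrier G" "x c \<in> carrier G"
        using g UV c xA by auto
      have "(inv\<^bsub>G\<^esub> x (g V) \<otimes>\<^bsub>G\<^esub> x c) \<otimes>\<^bsub>G\<^esub> inv\<^bsub>G\<^esub> (inv\<^bsub>G\<^esub> x (g U) \<otimes>\<^bsub>G\<^esub> x c) = inv\<^bsub>G\<^esub> x (g V) \<otimes>\<^bsub>G\<^esub> x (g U)"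
        using car by (simp add: inv_mult_group m_assoc cancel)
      then show "inv\<^bsub>G\<^esub> x (g V) \<otimes>\<^bsub>G\<^esub> x (g U) \<in> Q" using W(2)[OF c1 c2] by simp
    qed
  qed (rule dirU)
  then obtain y where y: "net_converges X \<U> (\<lambda>U V. V \<subseteq> U) (\<lambda>U. x (g U)) y"
    using compl unfolding complete_group_def by blast
  then have ycar: "y \<in> carrier G" using top by (simp add: net_converges_def)
  have trans_cont: "continuous_map X X (\<lambda>z. z0 \<otimes>\<^bsub>G\<^esub> z)" if "z0 \<in> carrier G" for z0
  proof -
    have "continuous_map X (prod_topology X X) (\<lambda>z. (z0, z))"
      using that top by (simp add: continuous_map_pairedI)
    from continuous_map_compose[OF this cmult] show ?thesis by (simp add: o_def)
  qed
  have "net_converges X A leq x y"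
    unfolding net_converges_def
  proof (intro conjI allI impI)
    show "y \<in> topspace X" using ycar top by simp
    fix Q assume Q: "openin X Q \<and> y \<in> Q"
    have "continuous_map (prod_topology X X) X (\<lambda>p. y \<otimes>\<^bsub>G\<^esub> (fst p \<otimes>\<^bsub>G\<^esub> snd p))"
      using continuous_map_compose[OF mult_comp[OF cont_fst cont_snd] trans_cont[OF ycar]]
      by (simp add: o_def)
    then have "continuous_map (prod_topology X X) X (\<lambda>(a, b). y \<otimes>\<^bsub>G\<^esub> (a \<otimes>\<^bsub>G\<^esub> b))"
      by (simp add: case_prod_unfold)
    then obtain W where W: "W \<in> \<U>" "\<And>a b. a \<in> W \<Longrightarrow> b \<in> W \<Longrightarrow> y \<otimes>\<^bsub>G\<^esub> (a \<otimes>\<^bsub>G\<^esub> b) \<in> Q"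
      using factor[of "\<lambda>a b. y \<otimes>\<^bsub>G\<^esub> (a \<otimes>\<^bsub>G\<^esub> b)" Q] Q ycar by auto
    define yW where "yW = {z \<in> topspace X. inv\<^bsub>G\<^esub> y \<otimes>\<^bsub>G\<^esub> z \<in> W}"
    have "openin X yW"
      using openin_continuous_map_preimage[OF trans_cont[OF inv_closed[OF ycar]]] W
      by (auto simp: \<U>_def yW_def)
    moreover have "y \<in> yW" using ycar top W by (auto simp: \<U>_def yW_def)
    ultimately have "\<exists>c\<in>\<U>. \<forall>a\<in>\<U>. a \<subseteq> c \<longrightarrow> x (g a) \<in> yW"
      using conjunct2[OF y[unfolded net_converges_def], THEN spec, of yW] by (rule_tac mp) simp_all
    then obtain V0 where V0: "V0 \<in> \<U>" "\<And>U. U \<in> \<U> \<Longrightarrow> U \<subseteq> V0 \<Longrightarrow> x (g U) \<in> yW"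
      by blast
    define V where "V = V0 \<inter> W"
    have V: "V \<in> \<U>" using V0 W by (auto simp: V_def \<U>_def)
    show "\<exists>c\<in>A. \<forall>a\<in>A. leq c a \<longrightarrow> x a \<in> Q"
    proof (intro bexI[OF _ g[OF V]] ballI impI)
      fix a assume a: "a \<in> A" "leq (g V) a"
      have "inv\<^bsub>G\<^esub> y \<otimes>\<^bsub>G\<^esub> x (g V) \<in> W" using V0(2)[OF V] by (simp add: V_def yW_def)
      moreover have "inv\<^bsub>G\<^esub> x (g V) \<otimes>\<^bsub>G\<^esub> x a \<in> W"
        using gU[OF V a(1) g[OF V] a(2) refl[OF g[OF V]]] by (simp add: V_def)
      ultimately have "y \<otimes>\<^bsub>G\<^esub> ((inv\<^bsub>G\<^esub> y \<otimes>\<^bsub>G\<^esub> x (g V)) \<otimes>\<^bsub>G\<^esub> (inv\<^bsub>G\<^esub> x (g V) \<otimes>\<^bsub>G\<^esub> x a)) \<in> Q"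
        by (rule W(2))
      moreover have car: "x (g V) \<in> carrier G" "x a \<in> carrier G" using xA g V a by auto
      have "(inv\<^bsub>G\<^esub> y \<otimes>\<^bsub>G\<^esub> x (g V)) \<otimes>\<^bsub>G\<^esub> (inv\<^bsub>G\<^esub> x (g V) \<otimes>\<^bsub>G\<^esub> x a) = inv\<^bsub>G\<^esub> y \<otimes>\<^bsub>G\<^esub> x a"
        using car ycar by (simp add: m_assoc cancel)
      moreover have "y \<otimes>\<^bsub>G\<^esub> (inv\<^bsub>G\<^esub> y \<otimes>\<^bsub>G\<^esub> x a) = x a"
        using car ycar by (simp add: cancel)
      ultimately show "x a \<in> Q" by simp
    qed
  qed
  then show ?thesis by blast
qed

end

theory Submission
  imports Defs
begin

text \<open>
  A left Cauchy net \<open>x\<close> of the weak direct product has componentwise limits \<open>l j\<close>, because boxes are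
  identity neighbourhoods. If infinitely many \<open>l j\<close> were nontrivial, a box separating \<open>l j\<close> from the
  identity for each of these \<open>j\<close> would contradict the Cauchy condition. To see that \<open>x\<close> tends to \<open>l\<close>,
  let \<open>F\<close> be the finite support of \<open>l\<inverse> x\<^sub>b\<close> and write
  \<open>l\<inverse> x\<^sub>b = (l\<inverse> x\<^sub>a)|\<^sub>F \<cdot> (x\<^sub>a\<inverse> x\<^sub>b)|\<^sub>F\<close>. The second factor is small by the Cauchy condition, as
  the identity has a basis of neighbourhoods (seminorm balls in the chart) that are stable under
  truncation to \<open>F\<close>; the first one is small for large \<open>a\<close>, since only finitely many components
  are involved.
\<close>

section \<open>Cauchy nets in weak direct products\<close>

lemma topological_group_mult_nbhd:
  assumes "topological_group G X" "openin X Q" "\<one>\<^bsub>G\<^esub> \<in> Q"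
  obtains W where "openin X W" "\<one>\<^bsub>G\<^esub> \<in> W" "\<And>a b. a \<in> W \<Longrightarrow> b \<in> W \<Longrightarrow> a \<otimes>\<^bsub>G\<^esub> b \<in> Q"
proof -
  interpret group G using assms(1) by (simp add: topological_group_def)
  have top: "topspace X = carrier G"
    and cont: "continuous_map (prod_topology X X) X (\<lambda>(x, y). x \<otimes>\<^bsub>G\<^esub> y)"
    using assms(1) by (auto simp: topological_group_def)
  define P where "P = {p \<in> topspace (prod_topology X X). (\<lambda>(x, y). x \<otimes>\<^bsub>G\<^esub> y) p \<in> Q}"
  have "openin (prod_topology X X) P"
    unfolding P_def by (rule openin_continuous_map_preimage[OF cont assms(2)])
  moreover have "(\<one>\<^bsub>G\<^esub>, \<one>\<^bsub>G\<^esub>) \<in> P" using assms top by (simp add: P_def)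
  ultimately obtain W1 W2 where W: "openin X W1" "openin X W2" "\<one>\<^bsub>G\<^esub> \<in> W1" "\<one>\<^bsub>G\<^esub> \<in> W2" "W1 \<times> W2 \<subseteq> P"
    unfolding openin_prod_topology_alt by metis
  show ?thesis
    by (rule that[of "W1 \<inter> W2"]) (use W in \<open>auto simp: P_def\<close>)
qed

lemma left_Cauchy_netD:
  assumes "left_Cauchy_net G X A leq x" "openin X U" "\<one>\<^bsub>G\<^esub> \<in> U"
  shows "\<exists>c\<in>A. \<forall>a\<in>A. \<forall>b\<in>A. leq c a \<and> leq c b \<longrightarrow> inv\<^bsub>G\<^esub> (x b) \<otimes>\<^bsub>G\<^esub> x a \<in> U"
proof -
  have "\<forall>U. openin X U \<and> \<one>\<^bsub>G\<^esub> \<in> U \<longrightarrow>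
      (\<exists>c\<in>A. \<forall>a\<in>A. \<forall>b\<in>A. leq c a \<and> leq c b \<longrightarrow> inv\<^bsub>G\<^esub> (x b) \<otimes>\<^bsub>G\<^esub> x a \<in> U)"
    using assms(1) unfolding left_Cauchy_net_def by (elim conjE)
  then show ?thesis using assms(2,3) by simp
qed

lemma net_convergesD:
  assumes "net_converges X A leq x l" "openin X U" "l \<in> U"
  shows "\<exists>c\<in>A. \<forall>a\<in>A. leq c a \<longrightarrow> x a \<in> U"
  using assms by (auto simp: net_converges_def)

lemma directed_set_ub:
  assumes "directed_set A leq" "a \<in> A" "b \<in> A"
  obtains c where "c \<in> A" "leq a c" "leq b c"
  using assms unfolding directed_set_def by blast

lemma directed_set_refl: "directed_set A leq \<Longrightarrow> a \<in> A \<Longrightarrow> leq a a"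
  unfolding directed_set_def by (elim conjE) (rule bspec)

lemma directed_set_trans:
  assumes "directed_set A leq" "a \<in> A" "b \<in> A" "c \<in> A" "leq a b" "leq b c"
  shows "leq a c"
  using assms unfolding directed_set_def by blast

text \<open>Directedness merges finitely many thresholds into one. Componentwise convergence is
  thereby made uniform over a finite support.\<close>

lemma directed_finite_eventually:
  assumes dir: "directed_set A leq" and "finite F"
    and "\<And>j. j \<in> F \<Longrightarrow> \<exists>c\<in>A. \<forall>a\<in>A. leq c a \<longrightarrow> P j a"
  shows "\<exists>c\<in>A. \<forall>a\<in>A. leq c a \<longrightarrow> (\<forall>j\<in>F. P j a)"
  using assms(2,3)
proof (induction F)
  case empty
  have "A \<noteq> {}" using dir unfolding directed_set_def by (elim conjE)
  then show ?case by blast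
next
  case (insert i F)
  have "\<exists>c\<in>A. \<forall>a\<in>A. leq c a \<longrightarrow> (\<forall>j\<in>F. P j a)"
    by (rule insert.IH, rule insert.prems) simp
  then obtain c where c: "c \<in> A" "\<And>a j. \<lbrakk>a \<in> A; leq c a; j \<in> F\<rbrakk> \<Longrightarrow> P j a"
    by blast
  obtain d where d: "d \<in> A" "\<And>a. \<lbrakk>a \<in> A; leq d a\<rbrakk> \<Longrightarrow> P i a"
    using insert.prems[OF insertI1] by blast
  obtain e where e: "e \<in> A" "leq c e" "leq d e"
    using directed_set_ub[OF dir c(1) d(1)] .
  show ?case
  proof (intro bexI[OF _ e(1)] ballI impI)
    fix a j assume a: "a \<in> A" "leq e a" "j \<in> insert i F"
    then show "P j a"
      using c(2) d(2) directed_set_trans[OF dir c(1) e(1) a(1) e(2) a(2)]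
        directed_set_trans[OF dir d(1) e(1) a(1) e(3) a(2)] by blast
  qed
qed

lemma topological_group_openin_translate:
  assumes "topological_group G X" "openin X Q" "x \<in> carrier G"
  shows "openin X {z \<in> topspace X. x \<otimes>\<^bsub>G\<^esub> z \<in> Q}"
proof -
  have "continuous_map X (prod_topology X X) (\<lambda>z. (x, z))"
    using assms by (simp add: continuous_map_pairedI topological_group_def)
  moreover have "continuous_map (prod_topology X X) X (\<lambda>(x, y). x \<otimes>\<^bsub>G\<^esub> y)"
    using assms(1) by (simp add: topological_group_def)
  ultimately have "continuous_map X X ((\<lambda>(x, y). x \<otimes>\<^bsub>G\<^esub> y) \<circ> (\<lambda>z. (x, z)))"
    by (rule continuous_map_compose)
  from openin_continuous_map_preimage[OF this assms(2)] show ?thesis by simp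
qed

lemma group_cancel_mid:
  assumes "group G" "a \<in> carrier G" "b \<in> carrier G" "c \<in> carrier G"
  shows "(a \<otimes>\<^bsub>G\<^esub> b) \<otimes>\<^bsub>G\<^esub> (inv\<^bsub>G\<^esub> b \<otimes>\<^bsub>G\<^esub> c) = a \<otimes>\<^bsub>G\<^esub> c"
proof -
  interpret group G by fact
  have "b \<otimes>\<^bsub>G\<^esub> (inv\<^bsub>G\<^esub> b \<otimes>\<^bsub>G\<^esub> c) = c" using assms by (simp add: m_assoc[symmetric])
  then show ?thesis using assms by (simp add: m_assoc)
qed

text \<open>Elements of \<open>sum_group J G\<close> are extensional on \<open>J\<close>, hence the
  restricted abstraction. The set \<open>F\<close> may be infinite and need not lie in
  \<open>J\<close>.\<close>

definition truncation :: "'j set \<Rightarrow> ('j \<Rightarrow> ('g, 'm) monoid_scheme) \<Rightarrow> 'j set \<Rightarrow> ('j \<Rightarrow> 'g) \<Rightarrow> 'j \<Rightarrow> 'g" where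
  "truncation J G F x = (\<lambda>j\<in>J. if j \<in> F then x j else \<one>\<^bsub>G j\<^esub>)"

text \<open>
  In the last axiom the size of the components in \<open>Q\<close> may depend on \<open>F\<close>; this leaves room for topologies
  finer than the box topology, such as the direct sum topology for uncountable \<open>J\<close>.
\<close>

locale weak_product_topology =
  fixes J :: "'j set" and G :: "'j \<Rightarrow> ('g, 'm) monoid_scheme" and X :: "'j \<Rightarrow> 'g topology"
    and Y :: "('j \<Rightarrow> 'g) topology"
  assumes factor: "j \<in> J \<Longrightarrow> topological_group (G j) (X j)"
    and factor_Hausdorff: "j \<in> J \<Longrightarrow> Hausdorff_space (X j)"
    and topological_group_sum: "topological_group (sum_group J G) Y"
    and box_nbhd: "(\<And>j. j \<in> J \<Longrightarrow> openin (X j) (Q j) \<and> \<one>\<^bsub>G j\<^esub> \<in> Q j) \<Longrightarrow>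
      \<exists>D. openin Y D \<and> \<one>\<^bsub>sum_group J G\<^esub> \<in> D \<and> D \<subseteq> Pi J Q"
    and truncation_nbhd: "openin Y P \<Longrightarrow> \<one>\<^bsub>sum_group J G\<^esub> \<in> P \<Longrightarrow>
      \<exists>B. openin Y B \<and> \<one>\<^bsub>sum_group J G\<^esub> \<in> B \<and> B \<subseteq> P \<and> (\<forall>z\<in>B. \<forall>F. truncation J G F z \<in> B) \<and>
        (\<forall>F\<subseteq>J. finite F \<longrightarrow> (\<exists>Q. (\<forall>j\<in>F. openin (X j) (Q j) \<and> \<one>\<^bsub>G j\<^esub> \<in> Q j) \<and>
          (\<forall>z\<in>carrier (sum_group J G). z \<in> Pi F Q \<longrightarrow> truncation J G F z \<in> B)))"
begin

section \<open>Components of elements and of Cauchy nets\<close>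

lemma group_factor: "j \<in> J \<Longrightarrow> group (G j)"
  using factor by (auto simp: topological_group_def)

lemma topspace_factor: "j \<in> J \<Longrightarrow> topspace (X j) = carrier (G j)"
  using factor by (auto simp: topological_group_def)

lemma openin_carrier_factor [simp]: "j \<in> J \<Longrightarrow> openin (X j) (carrier (G j))"
  using topspace_factor openin_topspace by metis

lemma one_mem_factor [simp]: "j \<in> J \<Longrightarrow> \<one>\<^bsub>G j\<^esub> \<in> carrier (G j)"
  using group_factor group.is_monoid monoid.one_closed by blast

sublocale sum: group "sum_group J G"
  using topological_group_sum by (simp add: topological_group_def)

lemma topspace_sum: "topspace Y = carrier (sum_group J G)"
  using topological_group_sum by (auto simp: topological_group_def)

lemma carrier_iff:
  "x \<in> carrier (sum_group J G) \<longleftrightarrow>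
    x \<in> (\<Pi>\<^sub>E j\<in>J. carrier (G j)) \<and> finite {j \<in> J. x j \<noteq> \<one>\<^bsub>G j\<^esub>}"
  using carrier_sum_group[of J G] group_factor by simp

lemma component_closed: "x \<in> carrier (sum_group J G) \<Longrightarrow> j \<in> J \<Longrightarrow> x j \<in> carrier (G j)"
  by (auto simp: carrier_iff)

lemma inv_component:
  assumes "x \<in> carrier (sum_group J G)" "j \<in> J"
  shows "(inv\<^bsub>sum_group J G\<^esub> x) j = inv\<^bsub>G j\<^esub> (x j)"
  using assms group_factor by (subst inv_sum_group) auto

lemma left_difference_component:
  assumes "x \<in> carrier (sum_group J G)" "j \<in> J"
  shows "(inv\<^bsub>sum_group J G\<^esub> x \<otimes>\<^bsub>sum_group J G\<^esub> y) j = inv\<^bsub>G j\<^esub> (x j) \<otimes>\<^bsub>G j\<^esub> y j"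
  using assms inv_component by simp

text \<open>A box contains an identity neighbourhood, so one index \<open>c\<close> serves all
  components at once. The Cauchy conditions of the single components would only give an index for
  each \<open>j\<close>.\<close>

lemma box_Cauchy:
  assumes "left_Cauchy_net (sum_group J G) Y A leq x"
    and "\<And>j. j \<in> J \<Longrightarrow> openin (X j) (Q j) \<and> \<one>\<^bsub>G j\<^esub> \<in> Q j"
  shows "\<exists>c\<in>A. \<forall>a\<in>A. \<forall>b\<in>A. leq c a \<and> leq c b \<longrightarrow>
    (\<forall>j\<in>J. inv\<^bsub>G j\<^esub> (x b j) \<otimes>\<^bsub>G j\<^esub> x a j \<in> Q j)"
proof -
  have x: "a \<in> A \<Longrightarrow> x a \<in> carrier (sum_group J G)" for a
    using assms(1) by (auto simp: left_Cauchy_net_def)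
  obtain D where D: "openin Y D" "\<one>\<^bsub>sum_group J G\<^esub> \<in> D" "D \<subseteq> Pi J Q"
    using box_nbhd[of Q] assms(2) by blast
  then obtain c where c: "c \<in> A" "\<And>a b. \<lbrakk>a \<in> A; b \<in> A; leq c a; leq c b\<rbrakk> \<Longrightarrow>
      inv\<^bsub>sum_group J G\<^esub> (x b) \<otimes>\<^bsub>sum_group J G\<^esub> x a \<in> D"
    using assms(1) unfolding left_Cauchy_net_def by metis
  show ?thesis
  proof (intro bexI[OF _ c(1)] ballI impI)
    fix a b j assume H: "a \<in> A" "b \<in> A" "leq c a \<and> leq c b" "j \<in> J"
    then have "inv\<^bsub>sum_group J G\<^esub> (x b) \<otimes>\<^bsub>sum_group J G\<^esub> x a \<in> Pi J Q"
      using c(2) D(3) by blast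
    then have "(inv\<^bsub>sum_group J G\<^esub> (x b) \<otimes>\<^bsub>sum_group J G\<^esub> x a) j \<in> Q j"
      using H by (blast dest: Pi_mem)
    then show "inv\<^bsub>G j\<^esub> (x b j) \<otimes>\<^bsub>G j\<^esub> x a j \<in> Q j"
      using left_difference_component[OF x] H by simp
  qed
qed

lemma component_Cauchy:
  assumes "left_Cauchy_net (sum_group J G) Y A leq x" "i \<in> J"
  shows "left_Cauchy_net (G i) (X i) A leq (\<lambda>a. x a i)"
  unfolding left_Cauchy_net_def
proof (intro conjI allI impI)
  show "directed_set A leq" using assms by (simp add: left_Cauchy_net_def)
  show "(\<lambda>a. x a i) \<in> A \<rightarrow> carrier (G i)"
    using assms(1) component_closed[OF _ assms(2)] by (auto simp: left_Cauchy_net_def)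
  fix U assume U: "openin (X i) U \<and> \<one>\<^bsub>G i\<^esub> \<in> U"
  \<comment> \<open>The box that constrains only the component \<open>i\<close>.\<close>
  define Q where "Q j = (if j = i then U else topspace (X j))" for j
  have "openin (X j) (Q j) \<and> \<one>\<^bsub>G j\<^esub> \<in> Q j" if "j \<in> J" for j
    using U that by (auto simp: Q_def topspace_factor)
  from box_Cauchy[OF assms(1) this]
  obtain c where "c \<in> A" and c: "\<And>a b. \<lbrakk>a \<in> A; b \<in> A; leq c a; leq c b\<rbrakk> \<Longrightarrow>
      \<forall>j\<in>J. inv\<^bsub>G j\<^esub> (x b j) \<otimes>\<^bsub>G j\<^esub> x a j \<in> Q j"
    by blast
  have "inv\<^bsub>G i\<^esub> x b i \<otimes>\<^bsub>G i\<^esub> x a i \<in> U" if "a \<in> A" "b \<in> A" "leq c a" "leq c b" for a b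
    using bspec[OF c[OF that] assms(2)] by (simp add: Q_def)
  then show "\<exists>c\<in>A. \<forall>a\<in>A. \<forall>b\<in>A. leq c a \<and> leq c b \<longrightarrow> inv\<^bsub>G i\<^esub> x b i \<otimes>\<^bsub>G i\<^esub> x a i \<in> U"
    using \<open>c \<in> A\<close> by blast
qed

text \<open>Separate each nontrivial \<open>l j\<close> from the identity by disjoint open sets
  \<open>V j\<close> and \<open>U j\<close>, and let \<open>c\<close> be a Cauchy index for the box
  of the \<open>U j\<close>. Where \<open>x c j\<close> is trivial, the later \<open>x a j\<close>
  stay in \<open>U j\<close> and cannot tend to \<open>l j\<close>. Thus the support of
  \<open>l\<close> lies in that of \<open>x c\<close>.\<close>

lemma limit_finite_support:
  assumes C: "left_Cauchy_net (sum_group J G) Y A leq x"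
    and l: "\<And>j. j \<in> J \<Longrightarrow> net_converges (X j) A leq (\<lambda>a. x a j) (l j)"
  shows "finite {j \<in> J. l j \<noteq> \<one>\<^bsub>G j\<^esub>}"
proof -
  have dir: "directed_set A leq" and x: "\<And>a. a \<in> A \<Longrightarrow> x a \<in> carrier (sum_group J G)"
    using C by (auto simp: left_Cauchy_net_def)
  \<comment> \<open>Where \<open>l j\<close> is trivial the relation only asks for open sets with
    the identity in the first, and the whole group serves for both. The choice then yields a box
    over all of \<open>J\<close>.\<close>
  define R where "R j U V \<longleftrightarrow> openin (X j) U \<and> openin (X j) V \<and> \<one>\<^bsub>G j\<^esub> \<in> U \<and>
    (l j \<noteq> \<one>\<^bsub>G j\<^esub> \<longrightarrow> l j \<in> V \<and> disjnt U V)" for j U V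
  have "\<exists>U V. R j U V" if "j \<in> J" for j
  proof (cases "l j = \<one>\<^bsub>G j\<^esub>")
    case True
    then have "R j (topspace (X j)) (topspace (X j))"
      using that by (simp add: R_def topspace_factor)
    then show ?thesis by blast
  next
    case False
    have "l j \<in> topspace (X j)" "\<one>\<^bsub>G j\<^esub> \<in> topspace (X j)"
      using l[OF that] that by (simp_all add: net_converges_def topspace_factor)
    then obtain U V where "openin (X j) U \<and> openin (X j) V \<and> \<one>\<^bsub>G j\<^esub> \<in> U \<and> l j \<in> V \<and> disjnt U V"
      using factor_Hausdorff[OF \<open>j \<in> J\<close>, unfolded Hausdorff_space_def,
          THEN spec, of "\<one>\<^bsub>G j\<^esub>", THEN spec, of "l j"] False by (elim impE exE) auto
    then have "R j U V" by (simp add: R_def)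
    then show ?thesis by blast
  qed
  then obtain U V where R: "\<And>j. j \<in> J \<Longrightarrow> R j (U j) (V j)"
    by metis
  have UV: "openin (X j) (U j) \<and> \<one>\<^bsub>G j\<^esub> \<in> U j" "openin (X j) (V j)" if "j \<in> J" for j
    using R[OF that] by (auto simp: R_def)
  have UV_sep: "l j \<in> V j \<and> disjnt (U j) (V j)" if "j \<in> J" "l j \<noteq> \<one>\<^bsub>G j\<^esub>" for j
    using R[OF that(1)] that(2) by (auto simp: R_def)
  obtain c where c: "c \<in> A" and cU: "\<And>a b j. \<lbrakk>a \<in> A; b \<in> A; leq c a; leq c b; j \<in> J\<rbrakk> \<Longrightarrow>
      inv\<^bsub>G j\<^esub> (x b j) \<otimes>\<^bsub>G j\<^esub> x a j \<in> U j"
    using box_Cauchy[of A leq x U, OF C UV(1)] by blast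
  have "{j \<in> J. l j \<noteq> \<one>\<^bsub>G j\<^esub>} \<subseteq> {j \<in> J. x c j \<noteq> \<one>\<^bsub>G j\<^esub>}"
  proof (intro subsetI CollectI conjI notI)
    fix j assume "j \<in> {j \<in> J. l j \<noteq> \<one>\<^bsub>G j\<^esub>}" and xc: "x c j = \<one>\<^bsub>G j\<^esub>"
    then have j: "j \<in> J" "l j \<noteq> \<one>\<^bsub>G j\<^esub>" by auto
    interpret Gj: group "G j" using group_factor[OF j(1)] .
    obtain d where d: "d \<in> A" "\<And>a. a \<in> A \<Longrightarrow> leq d a \<Longrightarrow> x a j \<in> V j"
      using net_convergesD[OF l[OF j(1)] UV(2)[OF j(1)] conjunct1[OF UV_sep[OF j]]] by blast
    obtain a where a: "a \<in> A" "leq c a" "leq d a"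
      using directed_set_ub[OF dir c d(1)] .
    \<comment> \<open>Compared with \<open>x c j\<close>, which is trivial, the left difference is
      \<open>x a j\<close> itself.\<close>
    have "x a j \<in> U j"
      using cU[OF a(1) c a(2) directed_set_refl[OF dir c] j(1)] xc component_closed[OF x[OF a(1)] j(1)] by simp
    then show False using d(2)[OF a(1) a(3)] UV_sep[OF j] by (auto simp: disjnt_def)
  qed simp
  moreover have "finite {j \<in> J. x c j \<noteq> \<one>\<^bsub>G j\<^esub>}" using x[OF c] by (simp add: carrier_iff)
  ultimately show ?thesis by (rule finite_subset)
qed

text \<open>The assumption \<open>comp\<close> concerns only the component nets of \<open>x\<close>,
  over the same index set. In this form the lemma covers nets and sequences alike.\<close>

lemma Cauchy_converges:
  assumes C: "left_Cauchy_net (sum_group J G) Y A leq x"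
    and comp: "\<And>j. j \<in> J \<Longrightarrow> left_Cauchy_net (G j) (X j) A leq (\<lambda>a. x a j) \<Longrightarrow>
      \<exists>l. net_converges (X j) A leq (\<lambda>a. x a j) l"
  shows "\<exists>l. net_converges Y A leq x l"
proof -
  let ?S = "sum_group J G"
  have dir: "directed_set A leq" and x: "\<And>a. a \<in> A \<Longrightarrow> x a \<in> carrier ?S"
    using C by (auto simp: left_Cauchy_net_def)
  obtain l' where l': "\<And>j. j \<in> J \<Longrightarrow> net_converges (X j) A leq (\<lambda>a. x a j) (l' j)"
  proof -
    have "\<forall>j\<in>J. \<exists>l. net_converges (X j) A leq (\<lambda>a. x a j) l"
      using comp[OF _ component_Cauchy[OF C]] by blast
    then show ?thesis using that by (auto dest!: bchoice)
  qed
  define l where "l = restrict l' J"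
  have conv: "net_converges (X j) A leq (\<lambda>a. x a j) (l j)" if "j \<in> J" for j
    using l'[OF that] that by (simp add: l_def)
  have "l \<in> (\<Pi>\<^sub>E j\<in>J. carrier (G j))"
    unfolding l_def using l' topspace_factor by (intro restrict_PiE_iff[THEN iffD2] ballI) (metis net_converges_def)
  then have l: "l \<in> carrier ?S"
    using limit_finite_support[OF C conv] by (simp add: carrier_iff)
  define y where "y a = inv\<^bsub>?S\<^esub> l \<otimes>\<^bsub>?S\<^esub> x a" for a
  have y: "y a \<in> carrier ?S" if "a \<in> A" for a
    unfolding y_def by (rule sum.m_closed[OF sum.inv_closed[OF l] x[OF that]])
  have y_component: "y a j = inv\<^bsub>G j\<^esub> (l j) \<otimes>\<^bsub>G j\<^esub> x a j" if "j \<in> J" for a j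
    unfolding y_def by (rule left_difference_component[OF l that])
  have "net_converges Y A leq x l"
    unfolding net_converges_def
  proof (intro conjI allI impI)
    show "l \<in> topspace Y" using l by (simp add: topspace_sum)
    fix P assume P: "openin Y P \<and> l \<in> P"
    \<comment> \<open>Translation by \<open>l\<close> reduces the claim to \<open>y a\<close> being
      eventually in an identity neighbourhood; \<open>W\<close> then leaves room for a product of
      two factors.\<close>
    define P' where "P' = {z \<in> topspace Y. l \<otimes>\<^bsub>?S\<^esub> z \<in> P}"
    have P': "openin Y P'"
      unfolding P'_def using topological_group_openin_translate[OF topological_group_sum _ l] P by blast
    have one: "\<one>\<^bsub>?S\<^esub> \<in> P'"
      unfolding P'_def mem_Collect_eq topspace_sum sum.r_one[OF l] using P by blast
    obtain W where W: "openin Y W" "\<one>\<^bsub>?S\<^esub> \<in> W" "\<And>a b. a \<in> W \<Longrightarrow> b \<in> W \<Longrightarrow> a \<otimes>\<^bsub>?S\<^esub> b \<in> P'"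
      using topological_group_mult_nbhd[OF topological_group_sum P' one] by blast
    obtain B where B: "openin Y B" "\<one>\<^bsub>?S\<^esub> \<in> B" "B \<subseteq> W" "\<forall>z\<in>B. \<forall>F. truncation J G F z \<in> B"
      and Bfin: "\<forall>F\<subseteq>J. finite F \<longrightarrow> (\<exists>Q. (\<forall>j\<in>F. openin (X j) (Q j) \<and> \<one>\<^bsub>G j\<^esub> \<in> Q j) \<and>
          (\<forall>z\<in>carrier ?S. z \<in> Pi F Q \<longrightarrow> truncation J G F z \<in> B))"
      using truncation_nbhd[OF W(1,2)] by blast
    obtain c where c: "c \<in> A" and cB: "\<And>a b. \<lbrakk>a \<in> A; b \<in> A; leq c a; leq c b\<rbrakk> \<Longrightarrow>
        inv\<^bsub>?S\<^esub> (x a) \<otimes>\<^bsub>?S\<^esub> x b \<in> B"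
    proof -
      have "\<exists>c\<in>A. \<forall>a\<in>A. \<forall>b\<in>A. leq c a \<and> leq c b \<longrightarrow> inv\<^bsub>?S\<^esub> (x b) \<otimes>\<^bsub>?S\<^esub> x a \<in> B"
        by (rule left_Cauchy_netD[OF C B(1,2)])
      then show ?thesis using that by blast
    qed
    \<comment> \<open>The Cauchy index \<open>c\<close> of \<open>B\<close> already works for the
      limit. For each \<open>b\<close> beyond it, an auxiliary index \<open>a\<close> is chosen that
      may depend on \<open>b\<close>, since it does not occur in the conclusion.\<close>
    show "\<exists>c\<in>A. \<forall>a\<in>A. leq c a \<longrightarrow> x a \<in> P"
    proof (intro bexI[OF _ c] ballI impI)
      fix b assume b: "b \<in> A" "leq c b"
      define F where "F = {j \<in> J. y b j \<noteq> \<one>\<^bsub>G j\<^esub>}"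
      have F: "F \<subseteq> J" "finite F" using y[OF b(1)] by (auto simp: F_def carrier_iff)
      then obtain Q where Q: "\<And>j. j \<in> F \<Longrightarrow> openin (X j) (Q j)" "\<And>j. j \<in> F \<Longrightarrow> \<one>\<^bsub>G j\<^esub> \<in> Q j"
        and QB: "\<And>z. \<lbrakk>z \<in> carrier ?S; z \<in> Pi F Q\<rbrakk> \<Longrightarrow> truncation J G F z \<in> B"
        using Bfin[THEN spec, THEN mp, THEN mp, OF F] by blast
      have "\<exists>c\<in>A. \<forall>a\<in>A. leq c a \<longrightarrow> y a j \<in> Q j" if "j \<in> F" for j
      proof -
        have j: "j \<in> J" using that F by blast
        interpret Gj: group "G j" using group_factor[OF j] .
        have lj: "l j \<in> carrier (G j)" using component_closed[OF l j] .
        \<comment> \<open>Membership of \<open>x a j\<close> in this neighbourhood of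
          \<open>l j\<close> says that \<open>y a j\<close> lies in \<open>Q j\<close>.\<close>
        let ?O = "{z \<in> topspace (X j). inv\<^bsub>G j\<^esub> (l j) \<otimes>\<^bsub>G j\<^esub> z \<in> Q j}"
        have "openin (X j) ?O"
          using topological_group_openin_translate[OF factor[OF j] Q(1)[OF that]] lj by simp
        moreover have "l j \<in> ?O" using lj Q(2)[OF that] topspace_factor[OF j] by simp
        ultimately have "\<exists>c\<in>A. \<forall>a\<in>A. leq c a \<longrightarrow> x a j \<in> ?O"
          by (rule net_convergesD[OF conv[OF j]])
        then obtain c where "c \<in> A" "\<And>a. a \<in> A \<Longrightarrow> leq c a \<Longrightarrow> x a j \<in> ?O" by blast
        then show ?thesis unfolding y_component[OF j] by (intro bexI[of _ c]) auto
      qed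
      then obtain d where d: "d \<in> A" "\<And>a. a \<in> A \<Longrightarrow> leq d a \<Longrightarrow> \<forall>j\<in>F. y a j \<in> Q j"
        using directed_finite_eventually[OF dir F(2), of "\<lambda>j a. y a j \<in> Q j"] by blast
      obtain a where a: "a \<in> A" "leq c a" "leq d a"
        using directed_set_ub[OF dir c d(1)] .
      let ?u = "truncation J G F (y a)"
      let ?v = "truncation J G F (inv\<^bsub>?S\<^esub> (x a) \<otimes>\<^bsub>?S\<^esub> x b)"
      have "y a \<in> Pi F Q" using d(2)[OF a(1,3)] by (intro Pi_I) (rule bspec)
      then have u: "?u \<in> W" using QB[OF y[OF a(1)]] B(3) by (intro subsetD[OF B(3)])
      have v: "?v \<in> W"
        by (intro subsetD[OF B(3)] B(4)[THEN bspec, THEN spec] cB a b)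
      \<comment> \<open>On \<open>F\<close> the factor \<open>x a j\<close> cancels. On the rest of
        \<open>J\<close> both truncations are trivial, and so is \<open>y b j\<close> because
        \<open>F\<close> is the support of \<open>y b\<close>. Off \<open>J\<close> both sides are
        \<open>undefined\<close>.\<close>
      have uv: "?u \<otimes>\<^bsub>?S\<^esub> ?v = y b"
      proof
        fix j show "(?u \<otimes>\<^bsub>?S\<^esub> ?v) j = y b j"
        proof (cases "j \<in> J")
          case j: True
          interpret Gj: group "G j" using group_factor[OF j] .
          have car: "x a j \<in> carrier (G j)" "x b j \<in> carrier (G j)" "l j \<in> carrier (G j)"
            using component_closed x l a(1) b(1) j by blast+
          have "inv\<^bsub>G j\<^esub> (l j) \<otimes>\<^bsub>G j\<^esub> x a j \<otimes>\<^bsub>G j\<^esub> (inv\<^bsub>G j\<^esub> (x a j) \<otimes>\<^bsub>G j\<^esub> x b j) = inv\<^bsub>G j\<^esub> (l j) \<otimes>\<^bsub>G j\<^esub> x b j"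
            by (rule group_cancel_mid[OF group_factor[OF j] Gj.inv_closed[OF car(3)] car(1,2)])
          then show ?thesis
            using j left_difference_component[OF x[OF a(1)] j, of "x b"] y_component[OF j]
            by (cases "j \<in> F") (simp_all add: truncation_def F_def del: inv_sum_group)
        next
          case False
          then show ?thesis
            using PiE_arb[OF conjunct1[OF y[OF b(1), unfolded carrier_iff]] False] by simp
        qed
      qed
      have "y b \<in> P'" using W(3)[OF u v] unfolding uv .
      then have "l \<otimes>\<^bsub>?S\<^esub> (inv\<^bsub>?S\<^esub> l \<otimes>\<^bsub>?S\<^esub> x b) \<in> P" unfolding P'_def y_def by blast
      also have "l \<otimes>\<^bsub>?S\<^esub> (inv\<^bsub>?S\<^esub> l \<otimes>\<^bsub>?S\<^esub> x b) = x b"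
        using sum.m_assoc[OF l sum.inv_closed[OF l] x[OF b(1)]] sum.r_inv[OF l] sum.l_one[OF x[OF b(1)]]
          by (simp del: mult_sum_group one_sum_group)
      finally show "x b \<in> P" .
    qed
  qed
  then show ?thesis by blast
qed

end

section \<open>Locally convex direct sums\<close>

text \<open>This form covers both preimages taken below: negation, with \<open>c = -1\<close> and
  \<open>a = 0\<close>, and the neighbourhoods of a point obtained by scaling and translating a
  fixed neighbourhood of \<open>0\<close>.\<close>

lemma locally_convex_tvs_affine_continuous:
  assumes "locally_convex_tvs E" "a \<in> topspace E"
  shows "continuous_map E E (\<lambda>y. c *\<^sub>R (y + a))"
proof -
  have add: "continuous_map (prod_topology E E) E (\<lambda>(x, y). x + y)"
    and scale: "continuous_map (prod_topology euclideanreal E) E (\<lambda>(c, x). c *\<^sub>R x)"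
    using assms(1) by (auto simp: locally_convex_tvs_def)
  have "continuous_map E (prod_topology E E) (\<lambda>y. (y, a))"
    using assms(2) by (intro continuous_map_pairedI) simp_all
  from continuous_map_compose[OF this add] have "continuous_map E E (\<lambda>y. y + a)"
    by (simp add: o_def)
  then have "continuous_map E (prod_topology euclideanreal E) (\<lambda>y. (c, y + a))"
    by (intro continuous_map_pairedI) simp_all
  from continuous_map_compose[OF this scale] show ?thesis by (simp add: o_def)
qed

section \<open>Continuous seminorms and the Minkowski functional\<close>

lemma continuous_seminorm_zero:
  assumes "subspace (topspace E)" "continuous_seminorm E q"
  shows "q 0 = 0"
proof -
  have "q (0 *\<^sub>R 0) = \<bar>0\<bar> * q 0"
    using assms subspace_0 unfolding continuous_seminorm_def by blast
  then show ?thesis by simp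
qed

text \<open>From \<open>0 = q (x - x) \<le> 2 * q x\<close>, by subadditivity and homogeneity with
  the factor -1.\<close>

lemma continuous_seminorm_nonneg:
  assumes "subspace (topspace E)" "continuous_seminorm E q" "x \<in> topspace E"
  shows "0 \<le> q x"
proof -
  have m: "(-1) *\<^sub>R x \<in> topspace E" using assms subspace_scale by blast
  have "q (x + (-1) *\<^sub>R x) \<le> q x + q ((-1) *\<^sub>R x)"
    using assms m unfolding continuous_seminorm_def by blast
  moreover have "q ((-1) *\<^sub>R x) = \<bar>-1\<bar> * q x"
    using assms unfolding continuous_seminorm_def by blast
  ultimately show ?thesis using continuous_seminorm_zero[OF assms(1,2)] by simp
qed

text \<open>The seminorm is the Minkowski functional of a symmetric convex open subset of \<open>U\<close>.\<close>

lemma locally_convex_tvs_seminorm_nbhd: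
  fixes E :: "'e::real_vector topology"
  assumes E: "locally_convex_tvs E" and U: "openin E U" "0 \<in> U"
  obtains q where "continuous_seminorm E q" "{x \<in> topspace E. q x < 1} \<subseteq> U"
proof -
  let ?S = "topspace E"
  have sub: "subspace ?S" using E by (simp add: locally_convex_tvs_def)
  have scale_cont: "continuous_map (prod_topology euclideanreal E) E (\<lambda>(c, x). c *\<^sub>R x)"
    using E by (simp add: locally_convex_tvs_def)
  have S0: "0 \<in> ?S" and Sadd: "\<And>x y. \<lbrakk>x \<in> ?S; y \<in> ?S\<rbrakk> \<Longrightarrow> x + y \<in> ?S"
    and Sscale: "\<And>c x. x \<in> ?S \<Longrightarrow> c *\<^sub>R x \<in> ?S"
    using sub by (auto simp: subspace_def)
  obtain C where C: "openin E C" "0 \<in> C" "convex C" "C \<subseteq> U"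
    using E U unfolding locally_convex_tvs_def by blast
  \<comment> \<open>Intersecting \<open>C\<close> with its negative gives homogeneity for negative
    scalars as well.\<close>
  define D where "D = {x \<in> ?S. x \<in> C \<and> - x \<in> C}"
  have preim: "openin E {x \<in> ?S. c *\<^sub>R (x + a) \<in> V}" if "openin E V" "a \<in> ?S" for V c a
    by (rule openin_continuous_map_preimage[OF locally_convex_tvs_affine_continuous[OF E that(2)] that(1)])
  have "D = C \<inter> {x \<in> ?S. (-1) *\<^sub>R (x + 0) \<in> C}"
    using openin_subset[OF C(1)] by (auto simp: D_def)
  then have D: "openin E D" using openin_Int[OF C(1) preim[OF C(1) S0]] by (rule ssubst)
  have D0: "0 \<in> D" using C S0 by (simp add: D_def)
  have Dneg: "- x \<in> D" if "x \<in> D" for x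
    using that Sscale[of x "-1"] by (simp add: D_def)
  have Dconv: "u *\<^sub>R x + v *\<^sub>R y \<in> D" if "x \<in> D" "y \<in> D" "0 \<le> u" "0 \<le> v" "u + v = 1" for x y u v
  proof -
    have "u *\<^sub>R (- x) + v *\<^sub>R (- y) \<in> C" "u *\<^sub>R x + v *\<^sub>R y \<in> C"
      using that C(3) unfolding D_def by (intro convexD; simp)+
    then show ?thesis using that Sadd Sscale by (auto simp: D_def)
  qed
  \<comment> \<open>The \<open>t > 0\<close> with \<open>x\<close> in the dilate of \<open>D\<close>
    by \<open>t\<close>; the infimum \<open>q x\<close> is the Minkowski functional of
    \<open>D\<close>.\<close>
  define T where "T x = {t. 0 < t \<and> (1 / t) *\<^sub>R x \<in> D}" for x :: 'e
  define q where "q x = Inf (T x)" for x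
  have bdd: "bdd_below (T x)" for x
    by (rule bdd_belowI[of _ 0]) (auto simp: T_def)
  have T_up: "s \<in> T x" if "t \<in> T x" "t \<le> s" for t s x
  proof -
    have t: "0 < t" "(1 / t) *\<^sub>R x \<in> D" using that by (auto simp: T_def)
    \<comment> \<open>The point \<open>x\<close> divided by \<open>s\<close> is a convex combination
      of \<open>x\<close> divided by \<open>t\<close> and \<open>0\<close>, so \<open>T x\<close> is
      closed upwards.\<close>
    have "(t / s) *\<^sub>R ((1 / t) *\<^sub>R x) + (1 - t / s) *\<^sub>R 0 \<in> D"
      using t that(2) by (intro Dconv D0) auto
    then show ?thesis using t that(2) by (simp add: T_def)
  qed
  have T_ne: "T x \<noteq> {}" if x: "x \<in> ?S" for x
  proof -
    have "continuous_map euclideanreal (prod_topology euclideanreal E) (\<lambda>c. (c, x))"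
      using x by (intro continuous_map_pairedI) simp_all
    from continuous_map_compose[OF this scale_cont]
    have "continuous_map euclideanreal E (\<lambda>c. c *\<^sub>R x)" by (simp add: o_def)
    from openin_continuous_map_preimage[OF this D]
    have "open {c. c *\<^sub>R x \<in> D}" by simp
    moreover have "0 \<in> {c. c *\<^sub>R x \<in> D}" using D0 by simp
    ultimately obtain e where e: "e > 0" "\<And>c. dist c 0 < e \<Longrightarrow> c *\<^sub>R x \<in> D"
      unfolding open_dist by blast
    have "2 / e \<in> T x" using e(1) e(2)[of "e / 2"] by (simp add: T_def)
    then show ?thesis by blast
  qed
  have q_less: "s \<in> T x" if "x \<in> ?S" "q x < s" for x s
  proof -
    obtain t where "t \<in> T x" "t < s"
      using cInf_lessD[OF T_ne[OF \<open>x \<in> ?S\<close>]] \<open>q x < s\<close> unfolding q_def by blast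
    then show ?thesis using T_up by simp
  qed
  have q_le: "q x \<le> s" if "s \<in> T x" for x s
    unfolding q_def by (rule cInf_lower[OF that bdd])
  have tri: "q (x + y) \<le> q x + q y" if x: "x \<in> ?S" and y: "y \<in> ?S" for x y
  proof (rule field_le_epsilon)
    fix e :: real assume e: "e > 0"
    define s t where "s = q x + e / 2" and "t = q y + e / 2"
    have "s \<in> T x" "t \<in> T y" using q_less x y e by (simp_all add: s_def t_def)
    then have st: "0 < s" "0 < t" "(1 / s) *\<^sub>R x \<in> D" "(1 / t) *\<^sub>R y \<in> D" by (auto simp: T_def)
    \<comment> \<open>With these weights the convex combination is \<open>x + y\<close> divided by
      \<open>s + t\<close>.\<close>
    have "(s / (s + t)) *\<^sub>R ((1 / s) *\<^sub>R x) + (t / (s + t)) *\<^sub>R ((1 / t) *\<^sub>R y) \<in> D"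
      using st by (intro Dconv) (simp_all add: add_divide_distrib[symmetric])
    then have "(1 / (s + t)) *\<^sub>R (x + y) \<in> D" using st by (simp add: scaleR_add_right)
    then have "s + t \<in> T (x + y)" using st by (simp add: T_def)
    from q_le[OF this] show "q (x + y) \<le> q x + q y + e" by (simp add: s_def t_def)
  qed
  have scale_T: "\<bar>c\<bar> * s \<in> T (c *\<^sub>R x)" if "s \<in> T x" "c \<noteq> 0" for c s x
  proof -
    have s: "0 < s" "(1 / s) *\<^sub>R x \<in> D" using that by (auto simp: T_def)
    \<comment> \<open>Only the sign of \<open>c\<close> survives, and \<open>D\<close> is
      symmetric.\<close>
    have "(1 / (\<bar>c\<bar> * s)) *\<^sub>R (c *\<^sub>R x) = sgn c *\<^sub>R ((1 / s) *\<^sub>R x)"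
      using that(2) s by (auto simp: sgn_if abs_if)
    also have "\<dots> \<in> D" using s(2) Dneg[OF s(2)] that(2) by (auto simp: sgn_if)
    finally show ?thesis using s that(2) by (simp add: T_def)
  qed
  have scale_le: "q (c *\<^sub>R x) \<le> \<bar>c\<bar> * q x" if x: "x \<in> ?S" and c: "c \<noteq> 0" for c x
  proof (rule field_le_epsilon)
    fix e :: real assume e: "e > 0"
    have "q x + e / \<bar>c\<bar> \<in> T x" using q_less[OF x] e c by simp
    from q_le[OF scale_T[OF this c]] show "q (c *\<^sub>R x) \<le> \<bar>c\<bar> * q x + e"
      using c by (simp add: distrib_left)
  qed
  have q0: "q 0 = 0"
  proof -
    have "T 0 = {0<..}" using D0 by (auto simp: T_def)
    then show ?thesis by (simp add: q_def)
  qed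
  have hom: "q (c *\<^sub>R x) = \<bar>c\<bar> * q x" if x: "x \<in> ?S" for c x
  proof (cases "c = 0")
    case True
    then show ?thesis using q0 by simp
  next
    case False
    \<comment> \<open>The converse inequality is the one already shown, applied to the inverse
      scalar.\<close>
    have "q ((1 / c) *\<^sub>R (c *\<^sub>R x)) \<le> \<bar>1 / c\<bar> * q (c *\<^sub>R x)"
      using scale_le[OF Sscale[OF x], of "1 / c" c] False by simp
    then have "\<bar>c\<bar> * q x \<le> q (c *\<^sub>R x)" using False by (simp add: field_simps)
    then show ?thesis using scale_le[OF x False] by simp
  qed
  have cont: "continuous_map E euclideanreal q"
    unfolding continuous_map_def
  proof (intro conjI allI impI)
    fix V :: "real set" assume V: "openin euclideanreal V"
    show "openin E {x \<in> ?S. q x \<in> V}"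
    proof (subst openin_subopen, intro ballI)
      fix x assume "x \<in> {x \<in> ?S. q x \<in> V}"
      then have x: "x \<in> ?S" "q x \<in> V" by auto
      obtain e where e: "e > 0" "\<And>r. dist r (q x) < e \<Longrightarrow> r \<in> V"
        using V x(2) unfolding open_openin[symmetric] open_dist by blast
      have mx: "- x \<in> ?S" using Sscale[OF x(1), of "-1"] by simp
      \<comment> \<open>This is \<open>x\<close> plus the dilate of \<open>D\<close> by
        \<open>e / 2\<close>. There \<open>q (y - x) \<le> e / 2\<close>, so \<open>q y\<close>
        differs from \<open>q x\<close> by less than \<open>e\<close>.\<close>
      define W where "W = {y \<in> ?S. (2 / e) *\<^sub>R (y + - x) \<in> D}"
      have "q y \<in> V" if y: "y \<in> W" for y
      proof -
        have yS: "y \<in> ?S" and "e / 2 \<in> T (y - x)"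
          using y e(1) by (auto simp: W_def T_def)
        from q_le[OF this(2)] have 1: "q (y - x) \<le> e / 2" .
        have d: "y - x \<in> ?S" using Sadd[OF yS mx] by simp
        have "q (x - y) = q (y - x)" using hom[OF d, of "-1"] by simp
        moreover have "q x \<le> q (x - y) + q y"
          using tri[of "x - y" y] Sscale[OF d, of "-1"] yS by simp
        moreover have "q y \<le> q (y - x) + q x" using tri[OF d x(1)] by simp
        ultimately have "dist (q y) (q x) < e" using 1 e(1) by (simp add: dist_real_def abs_le_iff)
        then show ?thesis by (rule e(2))
      qed
      moreover have "openin E W" unfolding W_def by (rule preim[OF D mx])
      moreover have "x \<in> W" using x D0 by (simp add: W_def)
      ultimately show "\<exists>W. openin E W \<and> x \<in> W \<and> W \<subseteq> {x \<in> ?S. q x \<in> V}"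
        using openin_subset by (intro exI[of _ W]) blast
    qed
  qed simp
  show ?thesis
  proof
    show "continuous_seminorm E q" using cont tri hom by (simp add: continuous_seminorm_def)
    show "{x \<in> ?S. q x < 1} \<subseteq> U"
    proof
      fix x assume "x \<in> {x \<in> ?S. q x < 1}"
      then have "1 \<in> T x" using q_less by blast
      then show "x \<in> U" using C(4) by (auto simp: T_def D_def)
    qed
  qed
qed

section \<open>Seminorm balls in the direct sum topology\<close>

definition sum_seminorm :: "('j \<Rightarrow> 'e::zero \<Rightarrow> real) \<Rightarrow> ('j \<Rightarrow>\<^sub>0 'e) \<Rightarrow> real" where
  "sum_seminorm q x = (\<Sum>j\<in>Poly_Mapping.keys x. q j (Poly_Mapping.lookup x j))"

text \<open>Gives a name to the seminorm that \<open>direct_sum_topology\<close> keeps local in a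
  \<open>let\<close>.\<close>

lemma direct_sum_topology_eq:
  "direct_sum_topology J E =
    topology_generated_by {{y \<in> direct_sum_carrier J (\<lambda>j. topspace (E j)). sum_seminorm q (y - x) < r} | q x r.
      (\<forall>j\<in>J. continuous_seminorm (E j) (q j)) \<and> x \<in> direct_sum_carrier J (\<lambda>j. topspace (E j)) \<and> r > 0}"
  by (simp add: direct_sum_topology_def sum_seminorm_def Let_def)

lemma zero_in_direct_sum_carrier:
  assumes "\<And>j. j \<in> J \<Longrightarrow> 0 \<in> S j"
  shows "0 \<in> direct_sum_carrier J S"
  using assms by (simp add: direct_sum_carrier_def)

lemma direct_sum_carrier_uminus:
  assumes "\<And>j. j \<in> J \<Longrightarrow> subspace (S j)" "x \<in> direct_sum_carrier J S"
  shows "- x \<in> direct_sum_carrier J S"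
  using assms by (auto simp: direct_sum_carrier_def subspace_neg)

text \<open>The sum runs over the keys of \<open>x\<close>, which vary with \<open>x\<close>. Over a
  common finite set \<open>K\<close> such sums become comparable, as the added terms are
  \<open>q j 0 = 0\<close>.\<close>

lemma sum_seminorm_mono_neutral:
  assumes "\<And>j. j \<in> K \<Longrightarrow> q j 0 = 0" "finite K" "Poly_Mapping.keys x \<subseteq> K"
  shows "sum_seminorm q x = (\<Sum>j\<in>K. q j (Poly_Mapping.lookup x j))"
  unfolding sum_seminorm_def
  by (rule sum.mono_neutral_left) (use assms in \<open>auto simp: in_keys_iff\<close>)

lemma sum_seminorm_triangle:
  assumes E: "\<And>j. j \<in> J \<Longrightarrow> subspace (topspace (E j))"
    and q: "\<And>j. j \<in> J \<Longrightarrow> continuous_seminorm (E j) (q j)"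
    and x: "x \<in> direct_sum_carrier J (\<lambda>j. topspace (E j))"
    and y: "y \<in> direct_sum_carrier J (\<lambda>j. topspace (E j))"
  shows "sum_seminorm q (x + y) \<le> sum_seminorm q x + sum_seminorm q y"
proof -
  let ?K = "Poly_Mapping.keys x \<union> Poly_Mapping.keys y"
  have K: "?K \<subseteq> J" "finite ?K" using x y by (auto simp: direct_sum_carrier_def)
  have z: "q j 0 = 0" if "j \<in> ?K" for j
    using continuous_seminorm_zero[OF E q] K that by blast
  have "q j (Poly_Mapping.lookup x j + Poly_Mapping.lookup y j) \<le>
      q j (Poly_Mapping.lookup x j) + q j (Poly_Mapping.lookup y j)" if "j \<in> ?K" for j
    using x y K that q[of j] by (auto simp: direct_sum_carrier_def continuous_seminorm_def)
  then have "(\<Sum>j\<in>?K. q j (Poly_Mapping.lookup (x + y) j)) \<le>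
      (\<Sum>j\<in>?K. q j (Poly_Mapping.lookup x j)) + (\<Sum>j\<in>?K. q j (Poly_Mapping.lookup y j))"
    unfolding lookup_add sum.distrib[symmetric] by (rule sum_mono)
  then show ?thesis
    using sum_seminorm_mono_neutral[of ?K q, OF z K(2)] Poly_Mapping.keys_add[of x y] by simp
qed

text \<open>A small ball of the sum lies in given balls of \<open>p\<close> and \<open>q\<close>
  about \<open>0\<close>, which handles intersections of neighbourhoods.\<close>

lemma continuous_seminorm_add:
  assumes "continuous_seminorm E p" "continuous_seminorm E q"
  shows "continuous_seminorm E (\<lambda>x. p x + q x)"
  using assms unfolding continuous_seminorm_def
  by (auto intro!: continuous_map_add simp: distrib_left) (smt (verit))

lemma sum_seminorm_add: "sum_seminorm (\<lambda>j x. p j x + q j x) x = sum_seminorm p x + sum_seminorm q x"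
  by (simp add: sum_seminorm_def sum.distrib)

lemma sum_seminorm_nonneg:
  assumes E: "\<And>j. j \<in> J \<Longrightarrow> subspace (topspace (E j))"
    and q: "\<And>j. j \<in> J \<Longrightarrow> continuous_seminorm (E j) (q j)"
    and x: "x \<in> direct_sum_carrier J (\<lambda>j. topspace (E j))"
  shows "0 \<le> sum_seminorm q x"
  unfolding sum_seminorm_def
  by (rule sum_nonneg, rule continuous_seminorm_nonneg[OF E q])
     (use x in \<open>auto simp: direct_sum_carrier_def\<close>)

lemma openin_direct_sum_ball:
  assumes E: "\<And>j. j \<in> J \<Longrightarrow> subspace (topspace (E j))"
    and q: "\<And>j. j \<in> J \<Longrightarrow> continuous_seminorm (E j) (q j)" and "r > 0"
  shows "openin (direct_sum_topology J E)
    {y \<in> direct_sum_carrier J (\<lambda>j. topspace (E j)). sum_seminorm q y < r}"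
  unfolding direct_sum_topology_eq
proof (rule topology_generated_by_Basis, intro CollectI exI conjI ballI)
  show "0 \<in> direct_sum_carrier J (\<lambda>j. topspace (E j))"
    by (rule zero_in_direct_sum_carrier) (simp add: E subspace_0)
qed (use assms in simp_all)

text \<open>The balls about arbitrary centres are only a subbasis by definition. Induction on the
  generated open sets shows that balls of a single seminorm about \<open>0\<close> form a
  neighbourhood base there.\<close>

lemma direct_sum_topology_nbhd_zero:
  assumes E: "\<And>j. j \<in> J \<Longrightarrow> subspace (topspace (E j))"
    and T: "openin (direct_sum_topology J E) T" "0 \<in> T"
  obtains q r where "\<And>j. j \<in> J \<Longrightarrow> continuous_seminorm (E j) (q j)" "r > 0"
    "{y \<in> direct_sum_carrier J (\<lambda>j. topspace (E j)). sum_seminorm q y < r} \<subseteq> T"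
proof -
  let ?S = "direct_sum_carrier J (\<lambda>j. topspace (E j))"
  let ?P = "\<lambda>T. \<exists>q r. (\<forall>j\<in>J. continuous_seminorm (E j) (q j)) \<and> r > 0 \<and> {y \<in> ?S. sum_seminorm q y < r} \<subseteq> T"
  have "?P T"
    using openin_topology_generated_by[OF T(1)[unfolded direct_sum_topology_eq]] T(2)
  proof induction
    case Empty
    then show ?case by simp
  next
    case (Int A B)
    obtain p r where p: "\<forall>j\<in>J. continuous_seminorm (E j) (p j)" "r > 0"
      and A: "{y \<in> ?S. sum_seminorm p y < r} \<subseteq> A"
      using Int by blast
    obtain q s where q: "\<forall>j\<in>J. continuous_seminorm (E j) (q j)" "s > 0"
      and B: "{y \<in> ?S. sum_seminorm q y < s} \<subseteq> B"
      using Int by blast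
    have "y \<in> A \<inter> B" if y: "y \<in> ?S" "sum_seminorm (\<lambda>j x. p j x + q j x) y < min r s" for y
    proof -
      have "0 \<le> sum_seminorm p y" "0 \<le> sum_seminorm q y"
        using sum_seminorm_nonneg[of J E, OF E _ y(1)] p(1) q(1) by blast+
      then show ?thesis using y A B by (auto simp: sum_seminorm_add)
    qed
    moreover have "\<forall>j\<in>J. continuous_seminorm (E j) (\<lambda>x. p j x + q j x)"
      using p q continuous_seminorm_add by blast
    ultimately show ?case using p(2) q(2)
      by (intro exI[of _ "\<lambda>j x. p j x + q j x"] exI[of _ "min r s"]) auto
  next
    case (UN K)
    then obtain k where k: "k \<in> K" "0 \<in> k" by blast
    then obtain q r where "\<forall>j\<in>J. continuous_seminorm (E j) (q j)" "r > 0" "{y \<in> ?S. sum_seminorm q y < r} \<subseteq> k"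
      using UN.IH by blast
    then show ?case using k(1) by blast
  next
    case (Basis B)
    then obtain q x r where B: "B = {y \<in> ?S. sum_seminorm q (y - x) < r}"
      and q: "\<forall>j\<in>J. continuous_seminorm (E j) (q j)" and x: "x \<in> ?S" and "r > 0"
      by blast
    have mx: "- x \<in> ?S" using direct_sum_carrier_uminus[OF _ x] E by simp
    \<comment> \<open>By the triangle inequality, a ball about \<open>x\<close> that contains
      \<open>0\<close> contains the ball about \<open>0\<close> whose radius is what remains after
      \<open>sum_seminorm q (- x)\<close>.\<close>
    have "y \<in> B" if "y \<in> ?S" "sum_seminorm q y < r - sum_seminorm q (- x)" for y
      using sum_seminorm_triangle[of J E q, OF E _ that(1) mx] q that by (simp add: B)
    moreover have "0 < r - sum_seminorm q (- x)" using Basis.prems by (simp add: B)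
    ultimately show ?case using q by (intro exI[of _ q] exI[of _ "r - sum_seminorm q (- x)"]) blast
  qed
  then show ?thesis using that by blast
qed

text \<open>One ball of \<open>sum_seminorm q\<close> controls all components simultaneously; hence
  boxes are neighbourhoods of \<open>0\<close> in the direct sum.\<close>

lemma seminorm_component_le_sum:
  assumes E: "\<And>j. j \<in> J \<Longrightarrow> subspace (topspace (E j))"
    and q: "\<And>j. j \<in> J \<Longrightarrow> continuous_seminorm (E j) (q j)"
    and x: "x \<in> direct_sum_carrier J (\<lambda>j. topspace (E j))" and j: "j \<in> J"
  shows "q j (Poly_Mapping.lookup x j) \<le> sum_seminorm q x"
proof (cases "j \<in> Poly_Mapping.keys x")
  case True
  show ?thesis unfolding sum_seminorm_def
  proof (rule member_le_sum[OF True])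
    fix i assume "i \<in> Poly_Mapping.keys x - {j}"
    then show "0 \<le> q i (Poly_Mapping.lookup x i)"
      using x continuous_seminorm_nonneg[OF E q] by (auto simp: direct_sum_carrier_def)
  qed simp
next
  case False
  then show ?thesis
    using continuous_seminorm_zero[OF E[OF j] q[OF j]] sum_seminorm_nonneg[OF E q x]
    by (simp add: in_keys_iff)
qed

text \<open>Passing from \<open>y\<close> to \<open>x\<close> drops nonnegative terms. This makes
  seminorm balls stable under truncation.\<close>

lemma sum_seminorm_mono:
  assumes E: "\<And>j. j \<in> J \<Longrightarrow> subspace (topspace (E j))"
    and q: "\<And>j. j \<in> J \<Longrightarrow> continuous_seminorm (E j) (q j)"
    and y: "y \<in> direct_sum_carrier J (\<lambda>j. topspace (E j))"
    and x: "\<And>j. j \<in> Poly_Mapping.keys x \<Longrightarrow> Poly_Mapping.lookup x j = Poly_Mapping.lookup y j"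
  shows "sum_seminorm q x \<le> sum_seminorm q y"
proof -
  have "Poly_Mapping.keys x \<subseteq> Poly_Mapping.keys y"
    using x by (auto simp: in_keys_iff)
  moreover have "0 \<le> q j (Poly_Mapping.lookup y j)" if "j \<in> Poly_Mapping.keys y" for j
    using that y continuous_seminorm_nonneg[OF E q] by (auto simp: direct_sum_carrier_def)
  ultimately have "(\<Sum>j\<in>Poly_Mapping.keys x. q j (Poly_Mapping.lookup y j)) \<le> sum_seminorm q y"
    unfolding sum_seminorm_def by (intro sum_mono2) auto
  then show ?thesis using x by (simp add: sum_seminorm_def)
qed

section \<open>Weak direct products of Lie groups\<close>

lemma diffeomorphism_bij_betw:
  assumes "diffeomorphism (open_submanifold M U) (open_submanifold (space_manifold E) V) \<phi>"
    and "U \<subseteq> topspace (mtop M)"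
  shows "bij_betw \<phi> U (topspace E \<inter> V)"
  using assms by (simp add: diffeomorphism_def open_submanifold_def space_manifold_def Int_absorb1)

lemma diffeomorphism_openin_preimage:
  assumes "diffeomorphism (open_submanifold M U) (open_submanifold (space_manifold E) V) \<phi>"
    and U: "openin (mtop M) U" and T: "openin E T"
  shows "openin (mtop M) {x \<in> U. \<phi> x \<in> T}"
proof -
  have sub: "U \<subseteq> topspace (mtop M)" using U by (rule openin_subset)
  have "continuous_map (subtopology (mtop M) U) (subtopology E V) \<phi>"
    using assms(1) by (simp add: diffeomorphism_def smooth_map_def open_submanifold_def space_manifold_def)
  then have "continuous_map (subtopology (mtop M) U) E \<phi>"
    by (rule continuous_map_into_fulltopology)
  from openin_continuous_map_preimage[OF this T]
  have "openin (subtopology (mtop M) U) {x \<in> U. \<phi> x \<in> T}"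
    by (simp add: Int_absorb1[OF sub])
  then show ?thesis by (rule openin_trans_full[OF _ U])
qed

text \<open>Continuity of the inverse chart determines \<open>T\<close> only within
  \<open>V\<close>, so the result is an equivalence for points of \<open>U\<close> instead of an
  equation of images.\<close>

lemma diffeomorphism_openin_image:
  assumes diffeo: "diffeomorphism (open_submanifold M U) (open_submanifold (space_manifold E) V) \<phi>"
    and U: "openin (mtop M) U" and Q: "openin (mtop M) Q"
  obtains T where "openin E T" "\<And>x. x \<in> U \<Longrightarrow> \<phi> x \<in> T \<longleftrightarrow> x \<in> Q"
proof -
  have sub: "U \<subseteq> topspace (mtop M)" using U by (rule openin_subset)
  have bij: "bij_betw \<phi> U (topspace E \<inter> V)" by (rule diffeomorphism_bij_betw[OF diffeo sub])
  have "continuous_map (subtopology E V) (subtopology (mtop M) U) (inv_into U \<phi>)"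
    using diffeo
    by (simp add: diffeomorphism_def smooth_map_def open_submanifold_def space_manifold_def Int_absorb1[OF sub])
  then have "continuous_map (subtopology E V) (mtop M) (inv_into U \<phi>)"
    by (rule continuous_map_into_fulltopology)
  from openin_continuous_map_preimage[OF this Q]
  have "openin (subtopology E V) {y \<in> topspace E \<inter> V. inv_into U \<phi> y \<in> Q}" by simp
  then obtain T where T: "openin E T" "{y \<in> topspace E \<inter> V. inv_into U \<phi> y \<in> Q} = T \<inter> V"
    unfolding openin_subtopology by blast
  show ?thesis
  proof (rule that[OF T(1)])
    fix x assume x: "x \<in> U"
    have "\<phi> x \<in> topspace E \<inter> V" using bij_betwE[OF bij] x by blast
    moreover have "inv_into U \<phi> (\<phi> x) = x" by (rule bij_betw_inv_into_left[OF bij x])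
    ultimately show "\<phi> x \<in> T \<longleftrightarrow> x \<in> Q" using T(2) by (simp add: set_eq_iff) metis
  qed
qed

text \<open>The two neighbourhood axioms are read off in the chart at the identity, where the
  topology is the direct sum topology; both are witnessed by the sets \<open>B q r\<close>.\<close>

lemma weak_direct_product_topology:
  fixes J :: "'j set"
    and G :: "'j \<Rightarrow> ('g, 'm) monoid_scheme"
    and M :: "'j \<Rightarrow> ('g, 'e::real_vector) manifold"
    and N :: "('j \<Rightarrow> 'g, 'j \<Rightarrow>\<^sub>0 'e) manifold"
  assumes G: "\<And>j. j \<in> J \<Longrightarrow> lie_group (G j) (M j)"
    and N: "weak_direct_product_lie_group J G M N"
  shows "weak_product_topology J G (\<lambda>j. mtop (M j)) (mtop N)"
proof -
  let ?S = "sum_group J G"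
  let ?E = "\<lambda>j. model (M j)"
  let ?D = "direct_sum_carrier J (\<lambda>j. topspace (?E j))"
  have lieN: "lie_group ?S N" and modelN: "model N = direct_sum_topology J ?E"
    using N by (simp_all add: weak_direct_product_lie_group_def)
  obtain U V \<phi> where
    chart: "\<forall>j\<in>J. openin (mtop (M j)) (U j) \<and> \<one>\<^bsub>G j\<^esub> \<in> U j \<and>
           openin (?E j) (V j) \<and> 0 \<in> V j \<and> \<phi> j \<one>\<^bsub>G j\<^esub> = 0 \<and>
           diffeomorphism (open_submanifold (M j) (U j))
             (open_submanifold (space_manifold (?E j)) (V j)) (\<phi> j)"
    and chartN: "let U' = carrier ?S \<inter> (\<Pi>\<^sub>E j\<in>J. U j);
             V' = direct_sum_carrier J V
         in openin (mtop N) U' \<and>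
            diffeomorphism (open_submanifold N U')
              (open_submanifold (space_manifold (model N)) V')
              (\<lambda>x. Abs_poly_mapping (\<lambda>j. \<phi> j (x j) when j \<in> J))"
    using N unfolding weak_direct_product_lie_group_def by (elim conjE exE) (rule that)
  define U' where "U' = carrier ?S \<inter> (\<Pi>\<^sub>E j\<in>J. U j)"
  define \<Phi> where "\<Phi> x = Abs_poly_mapping (\<lambda>j. \<phi> j (x j) when j \<in> J)" for x
  have U: "openin (mtop (M j)) (U j)" "\<one>\<^bsub>G j\<^esub> \<in> U j" and \<phi>_one: "\<phi> j \<one>\<^bsub>G j\<^esub> = 0"
    and \<phi>: "diffeomorphism (open_submanifold (M j) (U j))
             (open_submanifold (space_manifold (?E j)) (V j)) (\<phi> j)" if "j \<in> J" for j
    using bspec[OF chart that] by - (elim conjE; assumption)+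
  have U'_open: "openin (mtop N) U'"
    and \<Phi>: "diffeomorphism (open_submanifold N U')
              (open_submanifold (space_manifold (direct_sum_topology J ?E)) (direct_sum_carrier J V)) \<Phi>"
    using chartN unfolding Let_def modelN U'_def \<Phi>_def by - (elim conjE; assumption)+
  have lc: "locally_convex_tvs (?E j)" and haus: "Hausdorff_space (mtop (M j))"
    and grp: "group (G j)" and tg: "topological_group (G j) (mtop (M j))" if "j \<in> J" for j
    using lie_group.manifold[OF G[OF that]] lie_group.axioms(1)[OF G[OF that]]
      lie_group.topological_group[OF G[OF that]]
    by (simp_all add: smooth_manifold_def)
  have sub: "subspace (topspace (?E j))" if "j \<in> J" for j
    using lc[OF that] by (simp add: locally_convex_tvs_def)
  have carrier: "x \<in> carrier ?S \<longleftrightarrow>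
    x \<in> (\<Pi>\<^sub>E j\<in>J. carrier (G j)) \<and> finite {j \<in> J. x j \<noteq> \<one>\<^bsub>G j\<^esub>}" for x
    using carrier_sum_group[of J G] grp by simp
  have U_carrier: "U j \<subseteq> carrier (G j)" if "j \<in> J" for j
    using openin_subset[OF U(1)[OF that]] tg[OF that] by (simp add: topological_group_def)
  have U'_iff: "x \<in> U' \<longleftrightarrow> x \<in> (\<Pi>\<^sub>E j\<in>J. U j) \<and> finite {j \<in> J. x j \<noteq> \<one>\<^bsub>G j\<^esub>}" for x
    unfolding U'_def Int_iff carrier PiE_iff using U_carrier by blast
  have U'_component: "x j \<in> U j" if "x \<in> U'" "j \<in> J" for x j
    using that by (auto simp: U'_iff)
  have lookup: "Poly_Mapping.lookup (\<Phi> x) j = (\<phi> j (x j) when j \<in> J)" if "x \<in> U'" for x j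
  proof -
    \<comment> \<open>As \<open>\<phi> j\<close> sends the identity to \<open>0\<close>, the
      coordinate family has finite support, and \<open>Abs_poly_mapping\<close> returns it
      unchanged.\<close>
    have "{j. (\<phi> j (x j) when j \<in> J) \<noteq> 0} \<subseteq> {j \<in> J. x j \<noteq> \<one>\<^bsub>G j\<^esub>}"
      using \<phi>_one by auto
    moreover have "finite {j \<in> J. x j \<noteq> \<one>\<^bsub>G j\<^esub>}" using that by (simp add: U'_iff)
    ultimately have "finite {j. (\<phi> j (x j) when j \<in> J) \<noteq> 0}" by (rule finite_subset)
    then show ?thesis by (simp add: \<Phi>_def)
  qed
  have \<phi>_mem: "\<phi> j g \<in> topspace (?E j)" if "j \<in> J" "g \<in> U j" for j g
    using bij_betwE[OF diffeomorphism_bij_betw[OF \<phi>[OF that(1)] openin_subset[OF U(1)[OF that(1)]]]] that(2)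
    by blast
  have \<Phi>_mem: "\<Phi> x \<in> ?D" if "x \<in> U'" for x
    using \<phi>_mem U'_component[OF that] lookup[OF that]
    by (auto simp: direct_sum_carrier_def in_keys_iff)
  have one: "\<one>\<^bsub>?S\<^esub> \<in> U'"
    using U by (auto simp: U'_iff cong: conj_cong)
  have \<Phi>_one: "\<Phi> \<one>\<^bsub>?S\<^esub> = 0"
    by (rule poly_mapping_eqI) (use lookup[OF one] \<phi>_one in \<open>auto simp: when_def\<close>)
  \<comment> \<open>Only the components in \<open>F\<close> must lie in the chart domains;
    \<open>x\<close> itself may lie outside \<open>U'\<close>.\<close>
  have trunc_U': "truncation J G F x \<in> U'"
    if "x \<in> carrier ?S" "\<And>j. \<lbrakk>j \<in> J; j \<in> F\<rbrakk> \<Longrightarrow> x j \<in> U j" for x F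
  proof -
    have "{j \<in> J. truncation J G F x j \<noteq> \<one>\<^bsub>G j\<^esub>} \<subseteq> {j \<in> J. x j \<noteq> \<one>\<^bsub>G j\<^esub>}"
      by (auto simp: truncation_def)
    then have "finite {j \<in> J. truncation J G F x j \<noteq> \<one>\<^bsub>G j\<^esub>}"
      by (rule finite_subset) (use that(1) in \<open>simp add: carrier\<close>)
    moreover have "truncation J G F x \<in> (\<Pi>\<^sub>E j\<in>J. U j)"
      using that(2) U(2) by (auto simp: truncation_def)
    ultimately show ?thesis by (simp add: U'_iff)
  qed
  have lookup_trunc: "Poly_Mapping.lookup (\<Phi> (truncation J G F x)) j = (\<phi> j (x j) when j \<in> J \<inter> F)"
    if "truncation J G F x \<in> U'" for x F j
    using lookup[OF that] \<phi>_one by (auto simp: truncation_def when_def)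
  \<comment> \<open>Seminorm balls about \<open>0\<close>, pulled back along the chart.\<close>
  define B where "B q r = {x \<in> U'. sum_seminorm q (\<Phi> x) < r}" for q r
  have B_open: "openin (mtop N) (B q r)" and B_one: "\<one>\<^bsub>?S\<^esub> \<in> B q r"
    if "\<And>j. j \<in> J \<Longrightarrow> continuous_seminorm (?E j) (q j)" "r > 0" for q r
  proof -
    have "B q r = {x \<in> U'. \<Phi> x \<in> {y \<in> ?D. sum_seminorm q y < r}}"
      using \<Phi>_mem by (auto simp: B_def)
    then show "openin (mtop N) (B q r)"
      using diffeomorphism_openin_preimage[OF \<Phi> U'_open openin_direct_sum_ball[of J ?E, OF sub that]] by simp
    show "\<one>\<^bsub>?S\<^esub> \<in> B q r"
      using one \<Phi>_one \<open>r > 0\<close> by (simp add: B_def sum_seminorm_def del: one_sum_group)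
  qed
  show ?thesis
  proof
    show "topological_group (G j) (mtop (M j))" "Hausdorff_space (mtop (M j))" if "j \<in> J" for j
      using tg haus that by blast+
    show "topological_group ?S (mtop N)" by (rule lie_group.topological_group[OF lieN])
  next
    fix Q assume Q: "\<And>j. j \<in> J \<Longrightarrow> openin (mtop (M j)) (Q j) \<and> \<one>\<^bsub>G j\<^esub> \<in> Q j"
    \<comment> \<open>The seminorms are chosen independently for each \<open>j\<close> and scaled so
      that radius 1 suffices. The single ball \<open>B q 1\<close> then fits into the box.\<close>
    have "\<exists>q. continuous_seminorm (?E j) q \<and> (\<forall>g\<in>U j. q (\<phi> j g) < 1 \<longrightarrow> g \<in> Q j)" if j: "j \<in> J" for j
    proof -
      obtain T where T: "openin (?E j) T" "\<And>g. g \<in> U j \<Longrightarrow> \<phi> j g \<in> T \<longleftrightarrow> g \<in> Q j"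
        using diffeomorphism_openin_image[OF \<phi>[OF j] U(1)[OF j] conjunct1[OF Q[OF j]]] by blast
      have "0 \<in> T" using T(2)[OF U(2)[OF j]] \<phi>_one[OF j] Q[OF j] by simp
      then obtain q where "continuous_seminorm (?E j) q" "{x \<in> topspace (?E j). q x < 1} \<subseteq> T"
        using locally_convex_tvs_seminorm_nbhd[OF lc[OF j] T(1)] by blast
      then show ?thesis using T(2) \<phi>_mem[OF j] by blast
    qed
    then obtain q where q: "\<And>j. j \<in> J \<Longrightarrow> continuous_seminorm (?E j) (q j)"
      and qQ: "\<And>j g. \<lbrakk>j \<in> J; g \<in> U j; q j (\<phi> j g) < 1\<rbrakk> \<Longrightarrow> g \<in> Q j"
      by metis
    have "x j \<in> Q j" if "x \<in> B q 1" "j \<in> J" for x j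
    proof -
      have x: "x \<in> U'" "sum_seminorm q (\<Phi> x) < 1" using that by (auto simp: B_def)
      have "q j (\<phi> j (x j)) \<le> sum_seminorm q (\<Phi> x)"
        using seminorm_component_le_sum[of J ?E q, OF sub q \<Phi>_mem[OF x(1)] that(2)] lookup[OF x(1)] that(2)
        by simp
      then show ?thesis using qQ[OF that(2) U'_component[OF x(1) that(2)]] x(2) by simp
    qed
    then have "B q 1 \<subseteq> Pi J Q" by blast
    then show "\<exists>D. openin (mtop N) D \<and> \<one>\<^bsub>?S\<^esub> \<in> D \<and> D \<subseteq> Pi J Q"
      using B_open[OF q zero_less_one] B_one[OF q zero_less_one] by blast
  next
    fix P assume P: "openin (mtop N) P" "\<one>\<^bsub>?S\<^esub> \<in> P"
    obtain T where T: "openin (direct_sum_topology J ?E) T" "\<And>x. x \<in> U' \<Longrightarrow> \<Phi> x \<in> T \<longleftrightarrow> x \<in> P"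
      using diffeomorphism_openin_image[OF \<Phi> U'_open P(1)] by blast
    have "0 \<in> T" using T(2)[OF one] P(2) \<Phi>_one by (simp del: one_sum_group)
    from direct_sum_topology_nbhd_zero[of J ?E, OF sub T(1) this]
    obtain q r where q: "\<And>j. j \<in> J \<Longrightarrow> continuous_seminorm (?E j) (q j)" and r: "r > 0"
      and qT: "{y \<in> ?D. sum_seminorm q y < r} \<subseteq> T"
      by blast
    have sub_P: "B q r \<subseteq> P"
      using T(2) \<Phi>_mem qT by (auto simp: B_def)
    have trunc: "truncation J G F z \<in> B q r" if "z \<in> B q r" for z F
    proof -
      have z: "z \<in> U'" "sum_seminorm q (\<Phi> z) < r" using that by (auto simp: B_def)
      have t: "truncation J G F z \<in> U'"
        using z(1) U'_component[OF z(1)] by (intro trunc_U') (auto simp: U'_def)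
      have "sum_seminorm q (\<Phi> (truncation J G F z)) \<le> sum_seminorm q (\<Phi> z)"
      proof (rule sum_seminorm_mono[of J ?E, OF sub q \<Phi>_mem[OF z(1)]])
        fix j assume "j \<in> Poly_Mapping.keys (\<Phi> (truncation J G F z))"
        then show "Poly_Mapping.lookup (\<Phi> (truncation J G F z)) j = Poly_Mapping.lookup (\<Phi> z) j"
          using lookup_trunc[OF t] lookup[OF z(1)] by (auto simp: in_keys_iff when_def split: if_splits)
      qed
      then show ?thesis using t z(2) by (simp add: B_def)
    qed
    have fin: "\<exists>Q. (\<forall>j\<in>F. openin (mtop (M j)) (Q j) \<and> \<one>\<^bsub>G j\<^esub> \<in> Q j) \<and>
          (\<forall>z\<in>carrier ?S. z \<in> Pi F Q \<longrightarrow> truncation J G F z \<in> B q r)"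
      if F: "F \<subseteq> J" "finite F" for F
    proof -
      \<comment> \<open>A sum of \<open>card F\<close> terms below \<open>e\<close> stays strictly
        below \<open>r\<close>. The added 1 also covers the empty \<open>F\<close>.\<close>
      define e where "e = r / (card F + 1)"
      have e: "e > 0" using r by (simp add: e_def)
      define Q where "Q j = {g \<in> U j. \<phi> j g \<in> {x \<in> topspace (?E j). q j x \<in> {..<e}}}" for j
      have "openin (mtop (M j)) (Q j) \<and> \<one>\<^bsub>G j\<^esub> \<in> Q j" if "j \<in> F" for j
      proof
        have j: "j \<in> J" using that F by blast
        have "continuous_map (?E j) euclideanreal (q j)"
          using q[OF j] by (simp add: continuous_seminorm_def)
        then have "openin (?E j) {x \<in> topspace (?E j). q j x \<in> {..<e}}"
          by (rule openin_continuous_map_preimage) simp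
        then show "openin (mtop (M j)) (Q j)"
          unfolding Q_def by (rule diffeomorphism_openin_preimage[OF \<phi>[OF j] U(1)[OF j]])
        show "\<one>\<^bsub>G j\<^esub> \<in> Q j"
          using U(2)[OF j] \<phi>_one[OF j] continuous_seminorm_zero[OF sub[OF j] q[OF j]] e subspace_0[OF sub[OF j]]
          by (simp add: Q_def)
      qed
      moreover have "truncation J G F z \<in> B q r" if z: "z \<in> carrier ?S" "z \<in> Pi F Q" for z
      proof -
        have zQ: "z j \<in> U j" "q j (\<phi> j (z j)) < e" if "j \<in> F" for j
          using Pi_mem[OF z(2) that] by (auto simp: Q_def)
        have t: "truncation J G F z \<in> U'" using z(1) zQ(1) by (rule trunc_U')
        have "Poly_Mapping.keys (\<Phi> (truncation J G F z)) \<subseteq> F"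
          using lookup_trunc[OF t] by (auto simp: in_keys_iff when_def split: if_splits)
        then have "sum_seminorm q (\<Phi> (truncation J G F z)) =
            (\<Sum>j\<in>F. q j (Poly_Mapping.lookup (\<Phi> (truncation J G F z)) j))"
          using continuous_seminorm_zero[OF sub q] F by (intro sum_seminorm_mono_neutral) auto
        also have "\<dots> = (\<Sum>j\<in>F. q j (\<phi> j (z j)))"
          using F(1) by (intro sum.cong) (auto simp: lookup_trunc[OF t] when_def)
        also have "\<dots> \<le> (\<Sum>j\<in>F. e)"
          using zQ(2) by (intro sum_mono less_imp_le)
        also have "\<dots> < r" using r by (simp add: e_def field_simps)
        finally show ?thesis using t by (simp add: B_def)
      qed
      ultimately show ?thesis by (intro exI[of _ Q]) blast
    qed
    show "\<exists>B. openin (mtop N) B \<and> \<one>\<^bsub>?S\<^esub> \<in> B \<and> B \<subseteq> P \<and> (\<forall>z\<in>B. \<forall>F. truncation J G F z \<in> B) \<and>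
        (\<forall>F\<subseteq>J. finite F \<longrightarrow> (\<exists>Q. (\<forall>j\<in>F. openin (mtop (M j)) (Q j) \<and> \<one>\<^bsub>G j\<^esub> \<in> Q j) \<and>
          (\<forall>z\<in>carrier ?S. z \<in> Pi F Q \<longrightarrow> truncation J G F z \<in> B)))"
      using B_open[OF q r] B_one[OF q r] sub_P trunc fin by (intro exI[of _ "B q r"] conjI ballI allI impI)
  qed
qed

section \<open>Completeness of weak direct products\<close>

theorem theoremB:
  fixes J :: "'j set"
    and G :: "'j \<Rightarrow> ('g, 'm) monoid_scheme"
    and M :: "'j \<Rightarrow> ('g, 'e::real_vector) manifold"
    and N :: "('j \<Rightarrow> 'g, 'j \<Rightarrow>\<^sub>0 'e) manifold"
  assumes "\<And>j. j \<in> J \<Longrightarrow> lie_group (G j) (M j)"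
    and "weak_direct_product_lie_group J G M N"
  shows "((\<forall>j\<in>J. complete_group (G j) (mtop (M j))) \<longrightarrow>
            complete_group (sum_group J G) (mtop N)) \<and>
         ((\<forall>j\<in>J. sequentially_complete_group (G j) (mtop (M j))) \<longrightarrow>
            sequentially_complete_group (sum_group J G) (mtop N))"
proof (intro conjI impI)
  interpret weak_product_topology J G "\<lambda>j. mtop (M j)" "mtop N"
    using assms by (rule weak_direct_product_topology)
  show "complete_group (sum_group J G) (mtop N)"
    if compl: "\<forall>j\<in>J. complete_group (G j) (mtop (M j))"
    unfolding complete_group_def
  proof (intro allI impI)
    fix A :: "('j \<Rightarrow> 'g) set set" and leq x
    assume "left_Cauchy_net (sum_group J G) (mtop N) A leq x"
    then show "\<exists>l. net_converges (mtop N) A leq x l"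
    proof (rule Cauchy_converges)
      fix j assume j: "j \<in> J" and C: "left_Cauchy_net (G j) (mtop (M j)) A leq (\<lambda>a. x a j)"
      \<comment> \<open>Here the elements of \<open>A\<close> are sets of families, while
        \<open>complete_group (G j)\<close> concerns index sets of type \<open>'g set set\<close>;
        \<open>complete_groupD\<close> passes between index types.\<close>
      show "\<exists>l. net_converges (mtop (M j)) A leq (\<lambda>a. x a j) l"
        by (rule complete_groupD[OF factor[OF j] bspec[OF compl j] C])
    qed
  qed
  show "sequentially_complete_group (sum_group J G) (mtop N)"
    if compl: "\<forall>j\<in>J. sequentially_complete_group (G j) (mtop (M j))"
    unfolding sequentially_complete_group_def
  proof (intro allI impI)
    fix x assume "left_Cauchy_net (sum_group J G) (mtop N) (UNIV :: nat set) (\<le>) x"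
    then show "\<exists>l. net_converges (mtop N) UNIV (\<le>) x l"
    proof (rule Cauchy_converges)
      fix j assume j: "j \<in> J" and C: "left_Cauchy_net (G j) (mtop (M j)) (UNIV :: nat set) (\<le>) (\<lambda>a. x a j)"
      show "\<exists>l. net_converges (mtop (M j)) UNIV (\<le>) (\<lambda>a. x a j) l"
        using bspec[OF compl j] C unfolding sequentially_complete_group_def by (elim allE impE)
    qed
  qed
qed

end
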